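(* Let $f:\mathbb{B}^n\to\mathbb{B}^{N_1}$ and $g:\mathbb{B}^n\to\mathbb{B}^{N_2}$ be polynomial proper maps with the same source, where $f$ is of degree at least $2$ and $f(0)=0$. Let $m$ be an integer larger than the degree of $f$, fix $\theta\in(0,\frac{\pi}{2})$, and put $$j(f,g)=\cos(\theta)\,f\oplus\sin(\theta)\,(g\otimes z^{\otimes m}).$$ Then $\Gamma_{j(f,g)}=\Gamma_f\cap\Gamma_g$.
   Context: $\mathbb{B}^n$ is the open unit ball of $\mathbb{C}^n$ and $\mathrm{Aut}(\mathbb{B}^n)$ is its group of holomorphic automorphisms. For a rational proper map $f:\mathbb{B}^n\to\mathbb{B}^N$, the Hermitian invariant group is $$\Gamma_f=\{\gamma\in\mathrm{Aut}(\mathbb{B}^n):\ \text{there is } \psi\in\mathrm{Aut}(\mathbb{B}^N)\text{ with } f\circ\gamma=\psi\circ f\}.$$ $z^{\otimes m}$ is the $m$-fold tensor power of the identity map of $\mathbb{C}^n$, so $\|z^{\otimes m}\|^2=\|z\|^{2m}$; $g\otimes z^{\otimes m}$ is the pointwise tensor product of maps, and $\oplus$ is orthogonal sum. The map $j(f,g)$ is again a proper map between unit balls. *)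

theory Defs
  imports "HOL-Analysis.Analysis" "HOL-Library.Poly_Mapping"
begin

text \<open>Complex Frechet differentiability: the real derivative exists and is complex linear.\<close>

definition holomorphic_map_on ::
    "((complex, 'n::finite) vec \<Rightarrow> (complex, 'k::finite) vec) \<Rightarrow> (complex, 'n) vec set \<Rightarrow> bool" where
  "holomorphic_map_on f U \<longleftrightarrow>
     (\<forall>z\<in>U. \<exists>D. (f has_derivative D) (at z within U) \<and> Vector_Spaces.linear (*s) (*s) D)"

text \<open>
  Automorphisms are taken to be extensional (undefined off the ball), so that each
  automorphism is represented by exactly one HOL function.
\<close>

definition ball_automorphisms :: "((complex, 'n::finite) vec \<Rightarrow> (complex, 'n) vec) set" where
  "ball_automorphisms =
     {\<gamma> \<in> extensional (ball 0 1).
        bij_betw \<gamma> (ball 0 1) (ball 0 1) \<and>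
        holomorphic_map_on \<gamma> (ball 0 1) \<and>
        holomorphic_map_on (inv_into (ball 0 1) \<gamma>) (ball 0 1)}"

definition hermitian_invariant_group ::
    "((complex, 'n::finite) vec \<Rightarrow> (complex, 'k::finite) vec)
      \<Rightarrow> ((complex, 'n) vec \<Rightarrow> (complex, 'n) vec) set" where
  "hermitian_invariant_group f =
     {\<gamma> \<in> ball_automorphisms. \<exists>\<psi> \<in> ball_automorphisms. \<forall>z \<in> ball 0 1. f (\<gamma> z) = \<psi> (f z)}"

text \<open>
  Polynomials in the coordinates indexed by \<^typ>\<open>'n\<close> are finitely supported families of
  coefficients, indexed by the exponents of the monomials.
\<close>

type_synonym 'n cpoly = "('n \<Rightarrow>\<^sub>0 nat) \<Rightarrow>\<^sub>0 complex"

definition cpoly_eval :: "'n::finite cpoly \<Rightarrow> (complex, 'n) vec \<Rightarrow> complex" where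
  "cpoly_eval p z =
     (\<Sum>\<alpha>\<in>Poly_Mapping.keys p. Poly_Mapping.lookup p \<alpha> * (\<Prod>i\<in>UNIV. z $ i ^ Poly_Mapping.lookup \<alpha> i))"

definition cpoly_degree :: "'n::finite cpoly \<Rightarrow> nat" where
  "cpoly_degree p =
     Max (insert 0 ((\<lambda>\<alpha>. \<Sum>i\<in>UNIV. Poly_Mapping.lookup \<alpha> i) ` Poly_Mapping.keys p))"

definition polynomial_map ::
    "('n::finite cpoly, 'k::finite) vec \<Rightarrow> (complex, 'n) vec \<Rightarrow> (complex, 'k) vec" where
  "polynomial_map P z = (\<chi> k. cpoly_eval (P $ k) z)"

definition polynomial_map_degree :: "('n::finite cpoly, 'k::finite) vec \<Rightarrow> nat" where
  "polynomial_map_degree P = Max (range (\<lambda>k. cpoly_degree (P $ k)))"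

text \<open>
  \<^const>\<open>proper_map\<close> does not include continuity, which is automatic for the polynomial
  maps considered here; it does force the ball to be mapped into the ball.
\<close>

definition proper_ball_map ::
    "((complex, 'n::finite) vec \<Rightarrow> (complex, 'k::finite) vec) \<Rightarrow> bool" where
  "proper_ball_map f \<longleftrightarrow> proper_map (top_of_set (ball 0 1)) (top_of_set (ball 0 1)) f"

text \<open>
  Orthogonal sums and tensor products of coordinate spaces are the coordinate spaces over the
  disjoint sum and the product of the index types; the \<open>m\<close>-fold tensor power is indexed by
  \<open>m\<close>-tuples of indices, that is, by functions from a type with \<open>m\<close> elements.
\<close>

definition orthogonal_sum ::
    "(complex, 'a::finite) vec \<Rightarrow> (complex, 'b::finite) vec \<Rightarrow> (complex, 'a + 'b) vec"
    (infixr \<open>\<oplus>\<close> 65) where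
  "u \<oplus> v = (\<chi> s. case s of Inl a \<Rightarrow> u $ a | Inr b \<Rightarrow> v $ b)"

definition tensor_product ::
    "(complex, 'a::finite) vec \<Rightarrow> (complex, 'b::finite) vec \<Rightarrow> (complex, 'a \<times> 'b) vec"
    (infixr \<open>\<otimes>\<close> 70) where
  "u \<otimes> v = (\<chi> p. u $ fst p * v $ snd p)"

definition tensor_power ::
    "'m::finite itself \<Rightarrow> (complex, 'n::finite) vec \<Rightarrow> (complex, 'm \<Rightarrow> 'n) vec" where
  "tensor_power _ z = (\<chi> i. \<Prod>k\<in>UNIV. z $ i k)"

definition juxtaposition ::
    "'m::finite itself \<Rightarrow> real
      \<Rightarrow> ((complex, 'n::finite) vec \<Rightarrow> (complex, 'k::finite) vec)
      \<Rightarrow> ((complex, 'n) vec \<Rightarrow> (complex, 'l::finite) vec)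
      \<Rightarrow> (complex, 'n) vec \<Rightarrow> (complex, 'k + 'l \<times> ('m \<Rightarrow> 'n)) vec" where
  "juxtaposition m \<theta> f g z = cos \<theta> *\<^sub>R f z \<oplus> sin \<theta> *\<^sub>R (g z \<otimes> tensor_power m z)"

end

theory Submission
  imports Defs "HOL-Complex_Analysis.Conformal_Mappings"
begin

text \<open>
  Write \<open>j\<close> for the juxtaposition and \<open>\<langle>_, _\<rangle>\<close> for the Hermitian inner product.  The theorem rests on
  three facts.

  First, a polynomial map \<open>h\<close> of the ball into a ball with \<open>h 0 = 0\<close> and degree \<open>d \<ge> 2\<close> has only
  unitary source symmetries (\<open>hermitian_symmetry_fixes_0\<close>); this applies to \<open>f\<close> and to \<open>j\<close>.  Let
  \<open>h \<circ> \<gamma> = \<psi> \<circ> h\<close>, where \<open>\<gamma>\<close> sends \<open>a\<close> to \<open>0\<close> and \<open>\<psi>\<close> sends \<open>b\<close> to \<open>0\<close>.  If \<open>a \<noteq> 0\<close>, then \<open>h \<circ> \<gamma>\<close> has a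
  pole of order \<open>d\<close> along \<open>\<langle>z, a\<rangle> = 1\<close>, and the denominator of \<open>\<psi> \<circ> h\<close> is \<open>1 - \<langle>h, b\<rangle>\<close>, of degree at
  most \<open>d\<close>; hence \<open>1 - \<langle>h z, b\<rangle> = (1 - \<langle>z, a\<rangle>) ^ d\<close>.  The transformation law of \<open>1 - |z|\<^sup>2\<close> under
  automorphisms then says that \<open>(1 - |h|\<^sup>2) / (1 - |z|\<^sup>2) ^ d\<close> is \<open>\<gamma>\<close>-invariant up to a constant.  By the
  Schwarz lemma this function has its strict minimum at \<open>0\<close>, so \<open>\<gamma>\<close> fixes \<open>0\<close>: a contradiction.

  Second, a unitary \<open>V\<close> is a symmetry of a polynomial map \<open>h\<close> if and only if it preserves the Gram
  form \<open>\<langle>h z, h w\<rangle>\<close> (\<open>unitary_hermitian_symmetry_iff\<close>).  Comparing degrees shows that the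
  denominator of \<open>\<psi>\<close> is constant on the image of \<open>h\<close>; conversely, families with the same Gram form
  differ by a unitary map, a product of complex reflections.

  Third, the Gram form of \<open>j\<close> is
  \<open>cos\<^sup>2 \<theta> \<langle>f z, f w\<rangle> + sin\<^sup>2 \<theta> \<langle>g z, g w\<rangle> \<langle>z, w\<rangle> ^ m\<close>.  Since \<open>m\<close> exceeds the degree of \<open>f\<close>, the two
  summands occupy different degrees in \<open>z\<close>, and \<open>V\<close> preserves \<open>\<langle>z, w\<rangle>\<close>; so \<open>V\<close> preserves the form if
  and only if it preserves those of \<open>f\<close> and of \<open>g\<close> (\<open>gram_juxtaposition\<close>).

  The first two facts use the description of the automorphisms of the ball as unitary maps composed
  with explicit involutions, which follows from the Schwarz lemma on complex lines.
\<close>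

section \<open>The Hermitian inner product\<close>

definition cinner :: "(complex, 'n::finite) vec \<Rightarrow> (complex, 'n) vec \<Rightarrow> complex" where
  "cinner x y = (\<Sum>i\<in>UNIV. x $ i * cnj (y $ i))"

lemma cinner_add_left: "cinner (x + y) z = cinner x z + cinner y z"
  by (simp add: cinner_def distrib_right sum.distrib)

lemma cinner_diff_left: "cinner (x - y) z = cinner x z - cinner y z"
  by (simp add: cinner_def left_diff_distrib sum_subtractf)

lemma cinner_scale_left: "cinner (c *s x) z = c * cinner x z"
  by (simp add: cinner_def sum_distrib_left mult.assoc)

lemma cinner_add_right: "cinner z (x + y) = cinner z x + cinner z y"
  by (simp add: cinner_def distrib_left sum.distrib)

lemma cinner_diff_right: "cinner z (x - y) = cinner z x - cinner z y"
  by (simp add: cinner_def right_diff_distrib sum_subtractf)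

lemma cinner_scale_right: "cinner z (c *s x) = cnj c * cinner z x"
  by (simp add: cinner_def sum_distrib_left mult.left_commute)

lemma cinner_zero [simp]: "cinner 0 x = 0" "cinner x 0 = 0"
  by (simp_all add: cinner_def)

lemmas cinner_simps = cinner_add_left cinner_diff_left cinner_scale_left
  cinner_add_right cinner_diff_right cinner_scale_right

lemma cnj_cinner: "cnj (cinner x y) = cinner y x"
  by (simp add: cinner_def mult.commute)

lemma Re_cinner: "Re (cinner x y) = inner x y"
  by (simp add: cinner_def inner_vec_def inner_complex_def)

lemma cinner_self: "cinner x x = of_real ((norm x)\<^sup>2)"
proof -
  have "cinner x x \<in> \<real>"
    by (metis cnj_cinner Reals_cnj_iff)
  then show ?thesis
    by (metis Re_cinner of_real_Re power2_norm_eq_inner)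
qed

lemma norm_scale: "norm (c *s x) = cmod c * norm (x :: (complex, 'n::finite) vec)"
proof -
  have "complex_of_real ((norm (c *s x))\<^sup>2) = of_real ((cmod c)\<^sup>2) * cinner x x"
    unfolding cinner_self[symmetric] cinner_scale_left cinner_scale_right
    by (simp only: complex_norm_square mult.assoc mult.left_commute)
  also have "\<dots> = of_real ((cmod c * norm x)\<^sup>2)"
    by (simp add: cinner_self power_mult_distrib)
  finally have "(norm (c *s x))\<^sup>2 = (cmod c * norm x)\<^sup>2"
    using of_real_eq_iff by blast
  then show ?thesis by simp
qed

lemma cinner_Cauchy_Schwarz: "cmod (cinner x y) \<le> norm x * norm y"
proof -
  define r where "r = cmod (cinner x y)"
  obtain t where t: "cinner x y = r * cis t"
    using rcis_cmod_Arg[of "cinner x y"] unfolding r_def rcis_def by metis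
  have "cinner (cis (-t) *s x) y = of_real r"
    by (simp add: cinner_scale_left t mult.left_commute cis_mult)
  then have "r = inner (cis (-t) *s x) y"
    by (metis Re_cinner Re_complex_of_real)
  also have "\<dots> \<le> norm (cis (-t) *s x) * norm y" by (rule norm_cauchy_schwarz)
  finally show ?thesis by (simp add: norm_scale r_def)
qed

lemma one_minus_cinner_nonzero:
  assumes "norm x < 1" "norm y < 1" shows "1 - cinner x y \<noteq> 0"
proof
  assume "1 - cinner x y = 0"
  then have "1 \<le> norm x * norm y"
    using cinner_Cauchy_Schwarz[of x y] by (simp add: eq_diff_eq[symmetric])
  moreover have "norm x * norm y < 1 * 1"
    by (rule mult_strict_mono') (use assms in auto)
  ultimately show False by simp
qed

section \<open>Unitary maps\<close>

definition unitary_map :: "((complex, 'n::finite) vec \<Rightarrow> (complex, 'n) vec) \<Rightarrow> bool" where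
  "unitary_map V \<longleftrightarrow>
     Vector_Spaces.linear (*s) (*s) V \<and> (\<forall>x y. cinner (V x) (V y) = cinner x y)"

lemma unitary_map_add: "unitary_map V \<Longrightarrow> V (x + y) = V x + V y"
  and unitary_map_diff: "unitary_map V \<Longrightarrow> V (x - y) = V x - V y"
  and unitary_map_scale: "unitary_map V \<Longrightarrow> V (c *s x) = c *s V x"
  and unitary_map_zero: "unitary_map V \<Longrightarrow> V 0 = 0"
  by (auto simp: unitary_map_def dest: vec.linear_add vec.linear_diff vec.linear_scale vec.linear_0)

lemma unitary_map_cinner: "unitary_map V \<Longrightarrow> cinner (V x) (V y) = cinner x y"
  by (simp add: unitary_map_def)

lemma unitary_map_norm: "unitary_map V \<Longrightarrow> norm (V x) = norm x"
  using unitary_map_cinner[of V x x]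
  by (metis cinner_self of_real_eq_iff norm_ge_zero power2_eq_iff_nonneg)

lemma unitary_map_compose:
  assumes "unitary_map V" "unitary_map W" shows "unitary_map (\<lambda>x. V (W x))"
  using assms Vector_Spaces.linear_compose[of "(*s)" "(*s)" W "(*s)" V]
  by (auto simp: unitary_map_def comp_def)

lemma unitary_map_id: "unitary_map (\<lambda>x. x)"
  by (simp add: unitary_map_def vec.linear_ident)

lemma unitary_map_uminus: "unitary_map uminus"
proof -
  have "unitary_map (\<lambda>x::(complex, 'n::finite) vec. - x)"
    unfolding unitary_map_def
    using vec.linear_scale_self[of "-1"] by (auto simp: cinner_def)
  then show ?thesis .
qed

lemma unitary_map_bij: assumes "unitary_map V" shows "bij V"
proof -
  have "inj V"
  proof (rule injI)
    fix x y assume "V x = V y"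
    then have "norm (V (x - y)) = 0" by (simp add: unitary_map_diff[OF assms])
    then show "x = y" by (simp add: unitary_map_norm[OF assms])
  qed
  moreover from this have "surj V"
    using assms vec.linear_inj_imp_surj unfolding unitary_map_def by blast
  ultimately show ?thesis by (simp add: bij_def)
qed

lemma linear_isometry_unitary:
  assumes lin: "Vector_Spaces.linear (*s) (*s) V" and iso: "\<And>x. norm (V x) = norm x"
  shows "unitary_map V"
proof -
  have Re: "Re (cinner (V x) (V y)) = Re (cinner x y)" for x y
    unfolding Re_cinner dot_norm by (simp add: iso vec.linear_add[OF lin, symmetric])
  have "Im (cinner (V x) (V y)) = Im (cinner x y)" for x y
    using Re[of "\<i> *s x" y] by (simp add: vec.linear_scale[OF lin] cinner_scale_left)
  with Re lin show ?thesis by (simp add: unitary_map_def complex_eq_iff)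
qed

lemma unitary_map_inv: assumes "unitary_map V" shows "unitary_map (inv V)"
proof -
  have s: "V (inv V x) = x" for x
    by (meson assms bij_is_surj surj_f_inv_f unitary_map_bij)
  have inj: "inj V" using assms bij_is_inj unitary_map_bij by blast
  have "inv V (x + y) = inv V x + inv V y" for x y
    by (rule injD[OF inj]) (simp add: s unitary_map_add[OF assms])
  moreover have "inv V (c *s x) = c *s inv V x" for c x
    by (rule injD[OF inj]) (simp add: s unitary_map_scale[OF assms])
  ultimately have "Vector_Spaces.linear (*s) (*s) (inv V)"
    unfolding Vector_Spaces.linear_iff using vec.vector_space_axioms by blast
  then show ?thesis
    by (metis assms s linear_isometry_unitary unitary_map_norm)
qed

lemma bounded_linear_clinear:
  fixes V :: "(complex, 'n::finite) vec \<Rightarrow> (complex, 'k::finite) vec"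
  assumes "Vector_Spaces.linear (*s) (*s) V"
  shows "bounded_linear V"
proof -
  have sc: "r *\<^sub>R x = complex_of_real r *s (x :: (complex, 'm::finite) vec)" for r x
    by (simp add: vec_eq_iff) (simp add: scaleR_conv_of_real)
  have "linear V"
    by (rule linearI) (auto simp: vec.linear_add[OF assms] vec.linear_scale[OF assms] sc)
  then show ?thesis by (rule linear_conv_bounded_linear[THEN iffD1])
qed

text \<open>
  A complex Householder reflection: if \<open>u\<close> and \<open>v\<close> have the same norm and \<open>d = u - v\<close>, then
  rotating the line of \<open>d\<close> by a suitable unimodular number takes \<open>u\<close> to \<open>v\<close> and fixes the
  orthogonal complement of \<open>d\<close>.  The factor is forced, and it is unimodular because
  \<open>\<langle>v, d\<rangle> = - cnj \<langle>u, d\<rangle>\<close>.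
\<close>

lemma unitary_reflection:
  fixes u v :: "(complex, 'n::finite) vec"
  assumes "norm u = norm v"
  obtains R where "unitary_map R" "R u = v" "\<And>x. cinner x (u - v) = 0 \<Longrightarrow> R x = x"
proof (cases "u = v")
  case True
  then show ?thesis using that[OF unitary_map_id] by simp
next
  case False
  define d where "d = u - v"
  define p where "p = cinner u d"
  define D where "D = complex_of_real ((norm d)\<^sup>2)"
  have nn: "cinner u u = cinner v v" using assms by (simp add: cinner_self)
  have D: "D = cinner d d" by (simp add: D_def cinner_self)
  have "D = p + cnj p"
    unfolding D p_def d_def
    by (simp add: cinner_diff_left cinner_diff_right cnj_cinner nn)
  have "D \<noteq> 0" using False by (simp add: D_def d_def)
  have cD: "cnj D = D" by (simp add: D_def)
  have "p \<noteq> 0" using \<open>D = p + cnj p\<close> \<open>D \<noteq> 0\<close> by auto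
  define R where "R x = x - (cinner x d / p) *s d" for x
  have "R (x + y) = R x + R y" for x y
    by (simp add: R_def vec_eq_iff cinner_add_left add_divide_distrib distrib_right)
  moreover have "R (c *s x) = c *s R x" for c x
    by (simp add: R_def vec_eq_iff cinner_scale_left right_diff_distrib)
  ultimately have "Vector_Spaces.linear (*s) (*s) R"
    unfolding Vector_Spaces.linear_iff using vec.vector_space_axioms by blast
  moreover have "cinner (R x) (R y) = cinner x y" for x y
  proof -
    define X Y where "X = cinner x d" and "Y = cnj (cinner y d)"
    have "cinner d y = Y" by (simp add: Y_def cnj_cinner)
    then have "cinner (R x) (R y) = cinner x y - Y / cnj p * X - X / p * (Y - Y / cnj p * D)"
      unfolding R_def cinner_diff_left cinner_diff_right cinner_scale_left cinner_scale_right
        X_def[symmetric] D[symmetric]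
      by (simp add: Y_def[symmetric] algebra_simps)
    also have "\<dots> = cinner x y + X * Y * (D / (p * cnj p) - 1 / cnj p - 1 / p)"
      by (simp add: algebra_simps)
    also have "D / (p * cnj p) - 1 / cnj p - 1 / p = 0"
      using \<open>p \<noteq> 0\<close> unfolding \<open>D = p + cnj p\<close> by (simp add: add_divide_distrib)
    finally show ?thesis by simp
  qed
  ultimately have "unitary_map R" by (simp add: unitary_map_def)
  moreover have "R u = v"
    using \<open>p \<noteq> 0\<close> by (simp add: R_def p_def[symmetric]) (simp add: d_def)
  moreover have "R x = x" if "cinner x (u - v) = 0" for x
    using that by (simp add: R_def d_def)
  ultimately show ?thesis using that by blast
qed

text \<open>
  For a finite family the unitary map is a product of reflections, one for each new vector: the
  correction \<open>W (F s) - G s\<close> is orthogonal to the earlier vectors \<open>G x\<close>, so the reflection that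
  takes \<open>W (F s)\<close> to \<open>G s\<close> does not move them.
\<close>

lemma unitary_extension_finite:
  fixes F G :: "'a \<Rightarrow> (complex, 'n::finite) vec"
  assumes "finite S" and "\<And>x y. x \<in> S \<Longrightarrow> y \<in> S \<Longrightarrow> cinner (F x) (F y) = cinner (G x) (G y)"
  shows "\<exists>W. unitary_map W \<and> (\<forall>x\<in>S. W (F x) = G x)"
  using assms
proof (induction S)
  case empty
  then show ?case using unitary_map_id by blast
next
  case (insert s S)
  then obtain W where W: "unitary_map W" "\<And>x. x \<in> S \<Longrightarrow> W (F x) = G x" by auto
  have "cinner (W (F s)) (W (F s)) = cinner (G s) (G s)"
    using insert.prems W(1) by (simp add: unitary_map_cinner)
  then have "norm (W (F s)) = norm (G s)"
    by (metis cinner_self of_real_eq_iff norm_ge_zero power2_eq_iff_nonneg)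
  then obtain R where R: "unitary_map R" "R (W (F s)) = G s"
    "\<And>x. cinner x (W (F s) - G s) = 0 \<Longrightarrow> R x = x"
    using unitary_reflection by blast
  have "R (W (F x)) = G x" if "x \<in> S" for x
  proof -
    have "cinner (G x) (W (F s)) = cinner (W (F x)) (W (F s))" using W(2) that by simp
    also have "\<dots> = cinner (G x) (G s)"
      using insert.prems W(1) that by (simp add: unitary_map_cinner)
    finally have "R (G x) = G x" by (intro R(3)) (simp add: cinner_diff_right)
    then show ?thesis by (simp add: W(2) that)
  qed
  with R(2) unitary_map_compose[OF R(1) W(1)] show ?case
    by (intro exI[of _ "\<lambda>x. R (W x)"]) auto
qed

text \<open>
  In general it is enough to treat a finite subfamily such that the \<open>F x\<close> span: the Gram matrix
  determines the coordinates of every other vector.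
\<close>

lemma unitary_extension:
  fixes F G :: "'a \<Rightarrow> (complex, 'n::finite) vec"
  assumes gram: "\<And>x y. x \<in> S \<Longrightarrow> y \<in> S \<Longrightarrow> cinner (F x) (F y) = cinner (G x) (G y)"
  obtains W where "unitary_map W" "\<And>x. x \<in> S \<Longrightarrow> W (F x) = G x"
proof -
  obtain B where B: "B \<subseteq> F ` S" "vec.independent B" "F ` S \<subseteq> vec.span B"
    using vec.maximal_independent_subset by blast
  then have "finite B" using vec.finiteI_independent by blast
  then obtain T where T: "T \<subseteq> S" "finite T" "B = F ` T"
    using finite_subset_image[OF _ B(1)] by blast
  obtain W where W: "unitary_map W" "\<And>x. x \<in> T \<Longrightarrow> W (F x) = G x"
    using unitary_extension_finite[OF T(2), of F G] gram T(1) by (metis subsetD)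
  have "W (F x) = G x" if "x \<in> S" for x
  proof -
    \<comment> \<open>The vectors on which \<open>W\<close> is right when tested against all \<open>G z\<close> form a subspace
      containing the spanning family.\<close>
    define E where "E = {y. \<forall>z\<in>S. cinner (W y) (G z) = cinner y (F z)}"
    have sub: "vec.subspace E"
      unfolding vec.subspace_def E_def
      by (auto simp: unitary_map_zero[OF W(1)] unitary_map_add[OF W(1)]
            unitary_map_scale[OF W(1)] cinner_simps)
    have "B \<subseteq> E"
      unfolding T(3) E_def using T(1) gram W(2) by auto
    then have "vec.span B \<subseteq> E" by (rule vec.span_minimal[OF _ sub])
    then have "cinner (W (F x)) (G x) = cinner (F x) (F x)"
      using B(3) that by (auto simp: E_def)
    moreover have "cinner (G x) (W (F x)) = cnj (cinner (W (F x)) (G x))"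
      by (simp add: cnj_cinner)
    ultimately have "cinner (W (F x) - G x) (W (F x) - G x) = 0"
      using gram[OF that that]
      by (simp add: cinner_diff_left cinner_diff_right unitary_map_cinner[OF W(1)] cnj_cinner)
    then show ?thesis by (simp add: cinner_self)
  qed
  with W(1) that show ?thesis by blast
qed

section \<open>The Schwarz lemma and the automorphisms of the ball\<close>

lemma has_derivative_vec_nthI:
  fixes f :: "'a::real_normed_vector \<Rightarrow> (complex, 'k::finite) vec"
  assumes "\<And>i. ((\<lambda>x. f x $ i) has_derivative (\<lambda>h. D h $ i)) F"
  shows "(f has_derivative D) F"
proof -
  have bl: "bounded_linear (axis i :: complex \<Rightarrow> (complex, 'k) vec)" for i
  proof (rule bounded_linear_intro[where K = 1])
    show "axis i (x + y) = axis i x + axis i y" for x y :: complex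
      by (simp add: vec_eq_iff axis_def)
    show "axis i (r *\<^sub>R x) = r *\<^sub>R axis i x" for r and x :: complex
      by (simp add: vec_eq_iff axis_def)
    show "norm (axis i x :: (complex, 'k) vec) \<le> norm x * 1" for x :: complex
    proof -
      have "axis i x = (x *s axis i 1 :: (complex, 'k) vec)" by (simp add: vec_eq_iff axis_def)
      then show ?thesis by (simp add: norm_scale)
    qed
  qed
  have dec: "x = (\<Sum>i\<in>UNIV. axis i (x $ i))" for x :: "(complex, 'k) vec"
    by (simp add: vec_eq_iff axis_def)
  have "((\<lambda>x. \<Sum>i\<in>UNIV. axis i (f x $ i)) has_derivative (\<lambda>h. \<Sum>i\<in>UNIV. axis i (D h $ i))) F"
    by (intro has_derivative_sum bounded_linear.has_derivative[OF bl] assms)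
  then show ?thesis by (simp only: dec[symmetric])
qed

text \<open>
  Reduction to one variable: complex linearity of the Frechet derivative enters only through the
  holomorphy of the components along holomorphic curves.
\<close>

lemma holomorphic_map_curve:
  fixes \<gamma> :: "(complex, 'n::finite) vec \<Rightarrow> (complex, 'k::finite) vec"
  assumes hol: "holomorphic_map_on \<gamma> U" and "open U" "open T"
    and c: "\<And>i. (\<lambda>t. c t $ i) holomorphic_on T" and sub: "\<And>t. t \<in> T \<Longrightarrow> c t \<in> U"
  shows "(\<lambda>t. \<gamma> (c t) $ k) holomorphic_on T"
  unfolding holomorphic_on_def
proof
  fix t assume t: "t \<in> T"
  have "\<exists>d. ((\<lambda>t. c t $ i) has_field_derivative d) (at t)" for i
    using c t \<open>open T\<close> by (meson field_differentiable_def holomorphic_on_imp_differentiable_at)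
  then obtain d where d: "\<And>i. ((\<lambda>t. c t $ i) has_field_derivative d i) (at t)" by metis
  have c': "(c has_derivative (\<lambda>h. h *s (\<chi> i. d i))) (at t)"
  proof (rule has_derivative_vec_nthI)
    fix i
    have "(*) (d i) = (\<lambda>h. (h *s (\<chi> i. d i)) $ i)" by (auto simp: mult.commute)
    then show "((\<lambda>x. c x $ i) has_derivative (\<lambda>h. (h *s (\<chi> i. d i)) $ i)) (at t)"
      using d[of i] by (simp add: has_field_derivative_def)
  qed
  obtain D where D: "(\<gamma> has_derivative D) (at (c t))" and lin: "Vector_Spaces.linear (*s) (*s) D"
    using hol sub[OF t] \<open>open U\<close> unfolding holomorphic_map_on_def
    by (metis at_within_open)
  have "((\<lambda>t. \<gamma> (c t) $ k) has_derivative (\<lambda>h. D (h *s (\<chi> i. d i)) $ k)) (at t)"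
    by (rule bounded_linear.has_derivative[OF bounded_linear_vec_nth])
      (rule has_derivative_compose[OF c' D])
  moreover have "(\<lambda>h. D (h *s (\<chi> i. d i)) $ k) = (*) (D (\<chi> i. d i) $ k)"
    by (auto simp: vec.linear_scale[OF lin])
  ultimately have "((\<lambda>t. \<gamma> (c t) $ k) has_field_derivative D (\<chi> i. d i) $ k) (at t)"
    by (simp add: has_field_derivative_def)
  then show "(\<lambda>t. \<gamma> (c t) $ k) field_differentiable at t within T"
    using field_differentiable_at_within field_differentiable_def by blast
qed

lemma holomorphic_on_cinner:
  assumes "\<And>i. (\<lambda>t. c t $ i) holomorphic_on T"
  shows "(\<lambda>t. cinner (c t) w) holomorphic_on T"
  unfolding cinner_def using assms by (intro holomorphic_intros)

text \<open>
  The several-variable Schwarz lemma and its equality case, reduced to the disc by restricting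
  to complex lines through the origin and pairing with a unit vector.
\<close>

lemma Schwarz_ball:
  fixes G :: "(complex, 'n::finite) vec \<Rightarrow> (complex, 'k::finite) vec"
  assumes hol: "\<And>v i. norm v = 1 \<Longrightarrow> (\<lambda>t. G (t *s v) $ i) holomorphic_on ball 0 1"
    and ball: "\<And>z. norm z < 1 \<Longrightarrow> norm (G z) < 1" and "G 0 = 0"
  shows "norm z < 1 \<Longrightarrow> norm (G z) \<le> norm z"
    and "\<lbrakk>norm z < 1; norm (t *s z) < 1; norm (G z) = norm z;
          norm (G (t *s z)) = norm (t *s z)\<rbrakk> \<Longrightarrow> G (t *s z) = t *s G z"
proof -
  define v u where "v = (1 / of_real (norm z)) *s z" and "u = (1 / of_real (norm (G z))) *s G z"
  define F where "F = (\<lambda>t. cinner (G (t *s v)) u)"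
  define r where "r = complex_of_real (norm z)"
  have slice: "F holomorphic_on ball 0 1" "F 0 = 0" "\<And>t. norm t < 1 \<Longrightarrow> norm (F t) < 1"
      "F r = of_real (norm (G z))" "r *s v = z" "norm v = 1" "norm u = 1" "z = r *s v"
      "G z = of_real (norm (G z)) *s u"
    if "z \<noteq> 0" "G z \<noteq> 0"
  proof -
    show v: "norm v = 1" and u: "norm u = 1"
      using that by (auto simp: v_def u_def norm_scale norm_divide)
    show "F holomorphic_on ball 0 1"
      unfolding F_def by (rule holomorphic_on_cinner) (rule hol[OF v])
    show "F 0 = 0" by (simp add: F_def \<open>G 0 = 0\<close>)
    show "norm (F t) < 1" if "norm t < 1" for t
    proof -
      have "norm (F t) \<le> norm (G (t *s v))"
        unfolding F_def using cinner_Cauchy_Schwarz[of "G (t *s v)" u] u by simp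
      also have "\<dots> < 1" by (rule ball) (simp add: norm_scale v that)
      finally show ?thesis .
    qed
    show rv: "r *s v = z" using that by (simp add: r_def v_def)
    then show "z = r *s v" by simp
    show "F r = of_real (norm (G z))"
      using that unfolding F_def rv u_def
      by (simp add: cinner_scale_right cinner_self power2_eq_square)
    show "G z = of_real (norm (G z)) *s u" using that by (simp add: u_def)
  qed
  show "norm (G z) \<le> norm z" if "norm z < 1"
  proof (cases "z = 0 \<or> G z = 0")
    case True
    then show ?thesis using \<open>G 0 = 0\<close> by auto
  next
    case False
    then have "norm (F r) \<le> norm r"
      using Schwarz_Lemma(1)[OF slice(1,2), of r] slice(3) that by (auto simp: r_def)
    then show ?thesis using False slice(4) by (auto simp: r_def)
  qed
  show "G (t *s z) = t *s G z" if "norm z < 1" "norm (t *s z) < 1" "norm (G z) = norm z"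
    "norm (G (t *s z)) = norm (t *s z)"
  proof (cases "z = 0")
    case True
    then show ?thesis using \<open>G 0 = 0\<close> by simp
  next
    case False
    then have "G z \<noteq> 0" using that(3) by auto
    note s = slice[OF False this]
    have "norm r < 1" "r \<noteq> 0" using that(1) False by (auto simp: r_def)
    moreover have "F r = r" using s(4) that(3) by (simp add: r_def)
    ultimately obtain \<alpha> where \<alpha>: "\<And>t. norm t < 1 \<Longrightarrow> F t = \<alpha> * t"
      using Schwarz_Lemma(3)[OF s(1,2,3), of 0] by (metis norm_zero zero_less_one)
    with \<open>norm r < 1\<close> \<open>r \<noteq> 0\<close> \<open>F r = r\<close> have F: "F t = t" if "norm t < 1" for t
      by (metis mult_cancel_right2 mult_1 that)
    have tz: "t *s z = (t * r) *s v" unfolding s(5)[symmetric] by (simp add: vec.scale_scale)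
    have n: "norm (t * r) = norm (t *s z)" by (simp add: tz norm_scale s(6))
    have gu: "cinner (G (t *s z)) u = t * r"
      using F[of "t * r"] that(2) n unfolding F_def tz by simp
    have ug: "cinner u (G (t *s z)) = cnj (t * r)"
      unfolding gu[symmetric] by (simp add: cnj_cinner)
    have gg: "cinner (G (t *s z)) (G (t *s z)) = t * r * cnj (t * r)"
      unfolding cinner_self that(4) n[symmetric] by (rule complex_norm_square)
    have uu: "cinner u u = 1" by (simp add: cinner_self s(7))
    have "cinner (G (t *s z) - (t * r) *s u) (G (t *s z) - (t * r) *s u) = 0"
      unfolding cinner_diff_left cinner_diff_right cinner_scale_left cinner_scale_right gu ug gg uu
      by simp
    then have "G (t *s z) = (t * r) *s u" by (simp add: cinner_self)
    also have "\<dots> = t *s (r *s u)" by (simp add: vec.scale_scale)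
    also have "r *s u = G z" using s(9) that(3) by (simp add: r_def)
    finally show ?thesis .
  qed
qed

text \<open>
  The involution of the ball that interchanges \<open>0\<close> and \<open>a\<close>.  In the usual form its numerator is
  \<open>a - P z - s Q z\<close> with \<open>P\<close> and \<open>Q\<close> the projections onto the line of \<open>a\<close> and its complement
  and \<open>s = sqrt (1 - |a|\<^sup>2)\<close>; the formula below is the same map because
  \<open>|a|\<^sup>2 = (1 - s) (1 + s)\<close>, and it makes sense for \<open>a = 0\<close> too.
\<close>

definition ball_radical :: "(complex, 'n::finite) vec \<Rightarrow> complex" where
  "ball_radical a = of_real (sqrt (1 - (norm a)\<^sup>2))"

definition involution_part :: "(complex, 'n::finite) vec \<Rightarrow> (complex, 'n) vec \<Rightarrow> (complex, 'n) vec" where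
  "involution_part a z = ball_radical a *s z + (cinner z a / (1 + ball_radical a)) *s a"

definition ball_involution :: "(complex, 'n::finite) vec \<Rightarrow> (complex, 'n) vec \<Rightarrow> (complex, 'n) vec" where
  "ball_involution a z = (1 / (1 - cinner z a)) *s (a - involution_part a z)"

lemma ball_radical:
  assumes "norm a < 1"
  shows "(ball_radical a)\<^sup>2 = 1 - cinner a a" "cnj (ball_radical a) = ball_radical a"
    "1 + ball_radical a \<noteq> 0" "ball_radical a \<noteq> 0"
    "cinner a a = (1 - ball_radical a) * (1 + ball_radical a)"
proof -
  have p: "(norm a)\<^sup>2 < 1" using assms by (simp add: power_less_one_iff abs_square_less_1)
  show sq: "(ball_radical a)\<^sup>2 = 1 - cinner a a"
    using p by (simp add: ball_radical_def cinner_self flip: of_real_power)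
  show "cnj (ball_radical a) = ball_radical a" by (simp add: ball_radical_def)
  show "1 + ball_radical a \<noteq> 0"
    using p unfolding ball_radical_def
    by (metis add_pos_pos less_irrefl of_real_1 of_real_add of_real_eq_0_iff real_sqrt_gt_zero
        diff_gt_0_iff_gt zero_less_one)
  show "ball_radical a \<noteq> 0" using p by (simp add: ball_radical_def)
  show "cinner a a = (1 - ball_radical a) * (1 + ball_radical a)"
    using sq by (simp add: algebra_simps power2_eq_square)
qed

lemma involution_part_linear: "Vector_Spaces.linear (*s) (*s) (involution_part a)"
proof -
  have "involution_part a (x + y) = involution_part a x + involution_part a y" for x y
    by (simp add: involution_part_def vec_eq_iff cinner_add_left add_divide_distrib distrib_right distrib_left)
  moreover have "involution_part a (c *s x) = c *s involution_part a x" for c x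
    by (simp add: involution_part_def vec_eq_iff cinner_scale_left distrib_left)
  ultimately show ?thesis
    unfolding Vector_Spaces.linear_iff using vec.vector_space_axioms by blast
qed

lemma involution_part_cinner:
  assumes "norm a < 1"
  shows "cinner (involution_part a z) a = cinner z a"
    and "cinner (involution_part a z) (involution_part a w)
          = (ball_radical a)\<^sup>2 * cinner z w + cinner z a * cinner a w"
    and "involution_part a a = a"
    and "involution_part a (involution_part a z) = (ball_radical a)\<^sup>2 *s z + cinner z a *s a"
proof -
  define s where "s = ball_radical a"
  note r = ball_radical[OF assms, folded s_def]
  show 1: "cinner (involution_part a z) a = cinner z a" for z
  proof -
    have "cinner z a / (1 + s) * ((1 - s) * (1 + s)) = cinner z a * (1 - s)" using r(3) by simp
    then show ?thesis
      unfolding involution_part_def s_def[symmetric] cinner_add_left cinner_scale_left r(5)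
      by (simp add: algebra_simps)
  qed
  have q: "s * (1 / (1 + s)) + (1 / (1 + s)) * (1::complex) = 1"
    using r(3) by (simp add: field_simps)
  show "cinner (involution_part a z) (involution_part a w)
          = (ball_radical a)\<^sup>2 * cinner z w + cinner z a * cinner a w"
  proof -
    have cw: "cnj (cinner w a) = cinner a w" by (rule cnj_cinner)
    have "cinner (involution_part a z) (involution_part a w)
        = s * cinner (involution_part a z) w
          + cinner a w / (1 + s) * cinner (involution_part a z) a"
      unfolding involution_part_def[of a w] s_def[symmetric] cinner_add_right cinner_scale_right
      by (simp add: r(2) cw)
    also have "\<dots> = s * (s * cinner z w + cinner z a / (1 + s) * cinner a w)
          + cinner a w / (1 + s) * cinner z a"
      unfolding 1 by (simp add: involution_part_def s_def[symmetric] cinner_simps)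
    also have "\<dots> = s\<^sup>2 * cinner z w
        + cinner z a * cinner a w * (s * (1 / (1 + s)) + (1 / (1 + s)) * 1)"
      by (simp add: algebra_simps power2_eq_square)
    finally show ?thesis unfolding q by (simp add: s_def)
  qed
  show "involution_part a a = a"
  proof -
    have "(1 - s) * (1 + s) / (1 + s) = 1 - s" using r(3) by simp
    then show ?thesis
      unfolding involution_part_def s_def[symmetric] r(5)
      by (simp add: vec_eq_iff)
  qed
  show "involution_part a (involution_part a z) = (ball_radical a)\<^sup>2 *s z + cinner z a *s a"
  proof -
    have "involution_part a (involution_part a z)
        = s *s (s *s z + (cinner z a / (1 + s)) *s a) + (cinner z a / (1 + s)) *s a"
      unfolding involution_part_def[of a "involution_part a z"] 1
      by (simp add: involution_part_def s_def)
    also have "\<dots> = s\<^sup>2 *s z + (cinner z a * (s * (1 / (1 + s)) + (1 / (1 + s)) * 1)) *s a"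
      by (simp add: vec_eq_iff algebra_simps power2_eq_square)
    finally show ?thesis unfolding q by (simp add: s_def)
  qed
qed

text \<open>
  The polarized transformation law of the defining function of the ball.  It carries all metric
  information about automorphisms that is used below; in particular it makes the comparison of
  Gram forms possible without polarizing norm identities.
\<close>

lemma one_minus_cinner_involution:
  assumes a: "norm a < 1" and z: "norm z < 1" and w: "norm w < 1"
  shows "1 - cinner (ball_involution a z) (ball_involution a w)
      = (1 - cinner a a) * (1 - cinner z w) / ((1 - cinner z a) * (1 - cinner a w))"
proof -
  note nz = one_minus_cinner_nonzero[OF z a] one_minus_cinner_nonzero[OF a w]
  have c: "cnj (1 - cinner w a) = 1 - cinner a w" by (simp add: cnj_cinner)
  have L: "cinner a (involution_part a w) = cinner a w"
    by (metis a cnj_cinner involution_part_cinner(1))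
  have "cinner (ball_involution a z) (ball_involution a w)
      = cinner (a - involution_part a z) (a - involution_part a w)
        / ((1 - cinner z a) * (1 - cinner a w))"
    unfolding ball_involution_def cinner_scale_left cinner_scale_right
    by (simp add: cnj_cinner)
  also have "cinner (a - involution_part a z) (a - involution_part a w)
      = (1 - cinner z a) * (1 - cinner a w) - (1 - cinner a a) * (1 - cinner z w)"
    unfolding cinner_diff_left cinner_diff_right involution_part_cinner[OF a] L ball_radical(1)[OF a]
    by (simp add: algebra_simps)
  finally show ?thesis using nz by (simp add: diff_divide_distrib)
qed

lemma one_minus_norm_involution:
  assumes a: "norm a < 1" and z: "norm z < 1"
  shows "1 - (norm (ball_involution a z))\<^sup>2
      = (1 - (norm a)\<^sup>2) * (1 - (norm z)\<^sup>2) / (cmod (1 - cinner z a))\<^sup>2"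
proof -
  have "(1 - cinner z a) * (1 - cinner a z) = of_real ((cmod (1 - cinner z a))\<^sup>2)"
    by (simp only: complex_norm_square complex_cnj_diff complex_cnj_one cnj_cinner)
  then have "complex_of_real (1 - (norm (ball_involution a z))\<^sup>2)
      = of_real ((1 - (norm a)\<^sup>2) * (1 - (norm z)\<^sup>2) / (cmod (1 - cinner z a))\<^sup>2)"
    using one_minus_cinner_involution[OF a z z] by (simp add: cinner_self)
  then show ?thesis using of_real_eq_iff by blast
qed

lemma ball_involution_in_ball:
  assumes a: "norm a < 1" and z: "norm z < 1"
  shows "norm (ball_involution a z) < 1"
proof -
  have "(norm a)\<^sup>2 < 1" "(norm z)\<^sup>2 < 1" using a z by (simp_all add: abs_square_less_1)
  then have "0 < 1 - (norm (ball_involution a z))\<^sup>2"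
    unfolding one_minus_norm_involution[OF a z]
    using one_minus_cinner_nonzero[OF z a] by simp
  then show ?thesis using abs_square_less_1[of "norm (ball_involution a z)"] by simp
qed

lemma ball_involution_0: "ball_involution a 0 = a"
  by (simp add: ball_involution_def involution_part_def)

lemma ball_involution_involutive:
  assumes a: "norm a < 1" and z: "norm z < 1"
  shows "ball_involution a (ball_involution a z) = z"
proof -
  define k where "k = 1 - cinner z a"
  have k: "k \<noteq> 0" unfolding k_def by (rule one_minus_cinner_nonzero[OF z a])
  note r = ball_radical[OF a]
  have r0: "1 - cinner a a \<noteq> 0" using r(1,4) by (metis power_not_zero)
  have zk: "cinner z a = 1 - k" by (simp add: k_def)
  have "cinner (ball_involution a z) a = (cinner a a - cinner z a) / k"
    unfolding ball_involution_def cinner_scale_left cinner_diff_left involution_part_cinner[OF a]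
    by (simp add: k_def)
  then have 1: "1 - cinner (ball_involution a z) a = (1 - cinner a a) / k"
    using k by (simp add: zk diff_divide_distrib)
  have "involution_part a (ball_involution a z)
      = (1 / k) *s (a - ((1 - cinner a a) *s z + cinner z a *s a))"
    unfolding ball_involution_def k_def[symmetric]
      vec.linear_scale[OF involution_part_linear] vec.linear_diff[OF involution_part_linear]
      involution_part_cinner[OF a] r(1) ..
  also have "\<dots> = a - ((1 - cinner a a) / k) *s z"
    unfolding zk using k by (simp add: vec_eq_iff field_simps)
  finally have "a - involution_part a (ball_involution a z) = ((1 - cinner a a) / k) *s z" by simp
  then show ?thesis
    unfolding ball_involution_def[of a "ball_involution a z"] 1 using k r0 by simp
qed

lemma ball_involution_self: "norm a < 1 \<Longrightarrow> ball_involution a a = 0"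
  using ball_involution_involutive[of a 0] by (simp add: ball_involution_0)

lemma holomorphic_involution_curve:
  assumes a: "norm a < 1" and c: "\<And>i. (\<lambda>t. c t $ i) holomorphic_on T"
    and sub: "\<And>t. t \<in> T \<Longrightarrow> norm (c t) < 1"
  shows "(\<lambda>t. ball_involution a (c t) $ i) holomorphic_on T"
  unfolding ball_involution_def involution_part_def
  using one_minus_cinner_nonzero[OF sub a]
  by (auto intro!: holomorphic_intros holomorphic_on_cinner c ball_radical[OF a])

lemma ball_involution_differentiable_0:
  "\<exists>D. (ball_involution a has_derivative D) (at 0)"
proof -
  have bl: "bounded_linear (\<lambda>z. cinner z a)"
    unfolding cinner_def
    by (intro bounded_linear_sum bounded_linear_compose[OF bounded_linear_mult_left]
        bounded_linear_vec_nth)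
  have "\<exists>D. ((\<lambda>z. ball_involution a z $ i) has_derivative D) (at 0)" for i
  proof -
    have "(\<lambda>z. ball_involution a z $ i) differentiable (at 0)"
      unfolding ball_involution_def
      using bounded_linear_imp_differentiable[OF bl]
        bounded_linear_imp_differentiable[OF bounded_linear_compose[OF bounded_linear_vec_nth
          bounded_linear_clinear[OF involution_part_linear]]]
      by (auto intro!: differentiable_mult differentiable_divide differentiable_diff)
    then show ?thesis by (simp add: differentiable_def)
  qed
  then obtain D where "\<And>i. ((\<lambda>z. ball_involution a z $ i) has_derivative D i) (at 0)" by metis
  then have "(ball_involution a has_derivative (\<lambda>h. \<chi> i. D i h)) (at 0)"
    by (intro has_derivative_vec_nthI) simp
  then show ?thesis by blast
qed

text \<open>
  After composing with an involution one may assume that the origin is fixed; then the Schwarz lemma, for the map and its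
  inverse, shows that norms are preserved, its equality case gives complex homogeneity, and a
  homogeneous map that is differentiable at the origin is equal to its derivative.
\<close>

theorem ball_automorphism_decomposition:
  assumes "\<gamma> \<in> ball_automorphisms"
  obtains a V where "norm a < 1" "unitary_map V"
    "\<And>z. norm z < 1 \<Longrightarrow> \<gamma> z = V (ball_involution a z)"
proof -
  define \<delta> where "\<delta> = inv_into (ball 0 1) \<gamma>"
  have bij: "bij_betw \<gamma> (ball 0 1) (ball 0 1)" and hol: "holomorphic_map_on \<gamma> (ball 0 1)"
    and hol': "holomorphic_map_on \<delta> (ball 0 1)"
    using assms by (auto simp: ball_automorphisms_def \<delta>_def)
  have \<gamma>ball: "norm (\<gamma> z) < 1" if "norm z < 1" for z
    using bij_betwE[OF bij] that by simp
  have \<delta>: "norm (\<delta> z) < 1" "\<gamma> (\<delta> z) = z" if "norm z < 1" for z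
  proof -
    have "z \<in> \<gamma> ` ball 0 1" using bij that by (simp add: bij_betw_def)
    from inv_into_into[OF this] show "norm (\<delta> z) < 1" by (simp add: \<delta>_def)
    from f_inv_into_f[OF \<open>z \<in> \<gamma> ` ball 0 1\<close>] show "\<gamma> (\<delta> z) = z" by (simp add: \<delta>_def)
  qed
  have \<delta>\<gamma>: "\<delta> (\<gamma> z) = z" if "norm z < 1" for z
    unfolding \<delta>_def using bij that by (simp add: bij_betw_def)
  define a where "a = \<delta> 0"
  have a: "norm a < 1" "\<gamma> a = 0" by (simp_all add: a_def \<delta>)
  note inv = ball_involution_in_ball[OF a(1)] ball_involution_involutive[OF a(1)]
  define G where "G z = \<gamma> (ball_involution a z)" for z
  define K where "K z = ball_involution a (\<delta> z)" for z
  have line: "(\<lambda>t. (t *s v) $ i) holomorphic_on T" for v :: "(complex, 'a) vec" and i T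
    by (auto intro!: holomorphic_intros)
  have G1: "norm (G z) < 1" and K1: "norm (K z) < 1" and KG: "K (G z) = z"
    if "norm z < 1" for z
    using that by (simp_all add: G_def K_def inv \<gamma>ball \<delta> \<delta>\<gamma>)
  have G0: "G 0 = 0" and K0: "K 0 = 0"
    by (simp_all add: G_def K_def ball_involution_0 a ball_involution_self flip: a_def)
  have Ghol: "(\<lambda>t. G (t *s v) $ i) holomorphic_on ball 0 1" if "norm v = 1" for v i
    unfolding G_def
    by (rule holomorphic_map_curve[OF hol])
      (auto intro!: holomorphic_involution_curve[OF a(1)] line inv simp: norm_scale that
        simp del: vector_smult_component)
  have Khol: "(\<lambda>t. K (t *s v) $ i) holomorphic_on ball 0 1" if "norm v = 1" for v i
    unfolding K_def
    by (rule holomorphic_involution_curve[OF a(1)])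
      (auto intro!: holomorphic_map_curve[OF hol'] line \<delta> simp: norm_scale that
        simp del: vector_smult_component)
  have iso: "norm (G z) = norm z" if "norm z < 1" for z
  proof (rule antisym)
    show "norm (G z) \<le> norm z" by (rule Schwarz_ball(1)[OF Ghol G1 G0 that])
    have "norm (K (G z)) \<le> norm (G z)" by (rule Schwarz_ball(1)[OF Khol K1 K0 G1[OF that]])
    then show "norm z \<le> norm (G z)" by (simp add: KG that)
  qed
  have homog: "G (t *s z) = t *s G z" if "norm z < 1" "norm (t *s z) < 1" for t z
    by (rule Schwarz_ball(2)[OF Ghol G1 G0 that]) (auto intro: iso that)
  obtain D1 where D1: "(ball_involution a has_derivative D1) (at 0)"
    using ball_involution_differentiable_0 by blast
  have "a \<in> ball 0 1" using a(1) by simp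
  then obtain D2 where "(\<gamma> has_derivative D2) (at a within ball 0 1)"
    using hol unfolding holomorphic_map_on_def by blast
  then have D2: "(\<gamma> has_derivative D2) (at (ball_involution a 0))"
    using \<open>a \<in> ball 0 1\<close> by (simp add: at_within_open[OF _ open_ball] ball_involution_0)
  define V where "V h = D2 (D1 h)" for h
  have V: "(G has_derivative V) (at 0)"
    unfolding G_def V_def by (rule has_derivative_compose[OF D1 D2])
  then have bV: "bounded_linear V" by (rule has_derivative_bounded_linear)
  have sc: "r *\<^sub>R x = complex_of_real r *s (x :: (complex, 'a) vec)" for r x
    by (simp add: vec_eq_iff) (simp add: scaleR_conv_of_real)
  have VG: "V z = G z" if z: "norm z < 1" for z
  proof (cases "z = 0")
    case True
    then show ?thesis using G0 bV by (simp add: linear_simps)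
  next
    case False
    have "((\<lambda>t. G (t *\<^sub>R z)) has_derivative (\<lambda>t. V (t *\<^sub>R z))) (at 0)"
      by (rule has_derivative_compose[of _ _ _ _ G]) (auto intro!: derivative_eq_intros V)
    then have "((\<lambda>t. G (t *\<^sub>R z)) has_vector_derivative V z) (at 0)"
      using bV by (simp add: has_vector_derivative_def linear_simps)
    moreover have "((\<lambda>t. G (t *\<^sub>R z)) has_vector_derivative G z) (at 0)"
    proof (rule has_vector_derivative_transform_within_open)
      show "((\<lambda>t. t *\<^sub>R G z) has_vector_derivative G z) (at 0)"
        by (auto intro!: derivative_eq_intros)
      show "open (ball (0::real) 1)" "0 \<in> ball (0::real) 1" by auto
      fix t :: real assume "t \<in> ball 0 1"
      then have "norm (complex_of_real t *s z) < 1"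
        using z mult_right_mono[of "\<bar>t\<bar>" 1 "norm z"] by (simp add: norm_scale)
      then show "t *\<^sub>R G z = G (t *\<^sub>R z)" using homog[OF z] by (simp add: sc)
    qed
    ultimately show ?thesis by (rule vector_derivative_unique_at)
  qed
  have small: "\<exists>r::real. 0 < r \<and> norm (of_real r *s x) < 1 \<and> norm (of_real r *s y) < 1"
    for x y :: "(complex, 'a) vec"
  proof -
    define m where "m = 1 + norm x + norm y"
    have m: "0 < m" "norm x < m" "norm y < m"
      using norm_ge_zero[of x] norm_ge_zero[of y] unfolding m_def by linarith+
    have "norm (complex_of_real (1 / m) *s z) = norm z / m" for z :: "(complex, 'a) vec"
      using m(1) by (simp add: norm_scale norm_divide)
    with m show ?thesis
      by (intro exI[of _ "1 / m"]) (simp del: of_real_divide)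
  qed
  have Vsc: "V (complex_of_real r *s x) = of_real r *s V x" for r x
    using bV by (simp add: linear_simps flip: sc)
  have "V (c *s x) = c *s V x" for c x
  proof -
    obtain r where r: "0 < r" "norm (complex_of_real r *s x) < 1" "norm (complex_of_real r *s (c *s x)) < 1"
      using small by blast
    have e: "complex_of_real r *s (c *s x) = c *s (of_real r *s x)" by (simp add: mult.commute)
    have "of_real r *s V (c *s x) = V (c *s (complex_of_real r *s x))" by (simp only: Vsc[symmetric] e)
    also have "\<dots> = c *s V (of_real r *s x)"
      using homog[OF r(2), of c] r VG by (simp only: e)
    also have "\<dots> = of_real r *s (c *s V x)" by (simp add: Vsc mult.commute)
    finally show ?thesis using r(1) by (simp only: vec.scale_cancel_left) auto
  qed
  moreover have "V (x + y) = V x + V y" for x y using bV by (simp add: linear_simps)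
  ultimately have lin: "Vector_Spaces.linear (*s) (*s) V"
    unfolding Vector_Spaces.linear_iff using vec.vector_space_axioms by blast
  have "norm (V x) = norm x" for x
  proof -
    obtain r where r: "0 < r" "norm (complex_of_real r *s x) < 1" using small by blast
    then have "norm (V (complex_of_real r *s x)) = norm (complex_of_real r *s x)"
      by (simp add: VG iso)
    then show ?thesis using r(1) by (simp add: Vsc norm_scale)
  qed
  with lin have "unitary_map V" by (rule linear_isometry_unitary)
  moreover have "\<gamma> z = V (ball_involution a z)" if "norm z < 1" for z
    using VG[of "ball_involution a z"] that by (simp add: inv G_def)
  ultimately show ?thesis using a(1) that by blast
qed

corollary ball_automorphism_fixing_0:
  assumes "\<gamma> \<in> ball_automorphisms" "\<gamma> 0 = 0"
  obtains V where "unitary_map V" "\<And>z. norm z < 1 \<Longrightarrow> \<gamma> z = V z"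
proof -
  obtain a V where V: "norm a < 1" "unitary_map V"
    "\<And>z. norm z < 1 \<Longrightarrow> \<gamma> z = V (ball_involution a z)"
    using ball_automorphism_decomposition[OF assms(1)] by blast
  have "V a = 0" using V(3)[of 0] assms(2) by (simp add: ball_involution_0)
  then have "a = 0" using unitary_map_norm[OF V(2), of a] by simp
  then have "ball_involution a z = - z" for z
    by (simp add: ball_involution_def involution_part_def ball_radical_def)
  with V(3) unitary_map_compose[OF V(2) unitary_map_uminus] that show ?thesis by force
qed

lemma unitary_map_automorphism:
  assumes "unitary_map V"
  shows "restrict V (ball 0 1) \<in> ball_automorphisms"
proof -
  have surj: "V (inv V z) = z" for z
    by (meson assms bij_is_surj surj_f_inv_f unitary_map_bij)
  have inj: "inj V" using assms bij_is_inj unitary_map_bij by blast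
  have n: "norm (V z) = norm z" "norm (inv V z) = norm z" for z
    using unitary_map_norm assms unitary_map_inv by blast+
  have hol: "holomorphic_map_on W (ball 0 1)"
    if U: "unitary_map U" and eq: "\<And>z. norm z < 1 \<Longrightarrow> U z = W z"
    for U W :: "(complex, 'a) vec \<Rightarrow> (complex, 'a) vec"
    unfolding holomorphic_map_on_def
  proof (intro ballI exI conjI)
    fix z :: "(complex, 'a) vec" assume z: "z \<in> ball 0 1"
    show lin: "Vector_Spaces.linear (*s) (*s) U" using U by (simp add: unitary_map_def)
    show "(W has_derivative U) (at z within ball 0 1)"
      by (rule has_derivative_transform[OF z _
            bounded_linear_imp_has_derivative[OF bounded_linear_clinear[OF lin]]])
        (simp add: eq)
  qed
  have bij: "bij_betw (restrict V (ball 0 1)) (ball 0 1) (ball 0 1)"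
    by (rule bij_betwI[where g = "inv V"]) (auto simp: n surj inv_f_f[OF inj])
  have inv: "inv V z = inv_into (ball 0 1) (restrict V (ball 0 1)) z" if "norm z < 1" for z
  proof (rule inv_into_f_eq[symmetric])
    show "inj_on (restrict V (ball 0 1)) (ball 0 1)" using bij by (simp add: bij_betw_def)
  qed (use that in \<open>auto simp: n surj\<close>)
  show ?thesis
    unfolding ball_automorphisms_def
    using bij hol[OF assms, of "restrict V (ball 0 1)"] hol[OF unitary_map_inv[OF assms] inv]
    by simp
qed

section \<open>Polynomial functions of one variable\<close>

text \<open>
  Identities between polynomials are obtained near the origin, where all automorphisms are defined,
  and used at poles far outside the ball; so polynomials are handled as functions with a degree bound.
\<close>

definition polyfun :: "nat \<Rightarrow> (complex \<Rightarrow> complex) \<Rightarrow> bool" where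
  "polyfun n F \<longleftrightarrow> (\<exists>p. degree p \<le> n \<and> F = poly p)"

lemma polyfun_const: "polyfun n (\<lambda>_. c)"
  unfolding polyfun_def by (rule exI[of _ "[:c:]"]) auto

lemma polyfun_mono: "polyfun m F \<Longrightarrow> m \<le> n \<Longrightarrow> polyfun n F"
  unfolding polyfun_def using order_trans by blast

lemma polyfun_ident: "polyfun 1 (\<lambda>t. t)"
  unfolding polyfun_def by (rule exI[of _ "[:0, 1:]"]) auto

lemma polyfun_add: "polyfun n F \<Longrightarrow> polyfun n G \<Longrightarrow> polyfun n (\<lambda>t. F t + G t)"
  unfolding polyfun_def
proof (elim exE conjE)
  fix p q assume "degree p \<le> n" "F = poly p" "degree q \<le> n" "G = poly q"
  then show "\<exists>r. degree r \<le> n \<and> (\<lambda>t. F t + G t) = poly r"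
    by (intro exI[of _ "p + q"]) (auto simp: degree_add_le)
qed

lemma polyfun_mult: "polyfun m F \<Longrightarrow> polyfun n G \<Longrightarrow> polyfun (m + n) (\<lambda>t. F t * G t)"
  unfolding polyfun_def
proof (elim exE conjE)
  fix p q assume "degree p \<le> m" "F = poly p" "degree q \<le> n" "G = poly q"
  then show "\<exists>r. degree r \<le> m + n \<and> (\<lambda>t. F t * G t) = poly r"
    by (intro exI[of _ "p * q"]) (auto intro!: order_trans[OF degree_mult_le])
qed

lemma polyfun_cmult: "polyfun n F \<Longrightarrow> polyfun n (\<lambda>t. c * F t)"
  using polyfun_mult[OF polyfun_const[of 0 c], of n F] by simp

lemma polyfun_multc: "polyfun n F \<Longrightarrow> polyfun n (\<lambda>t. F t * c)"
  using polyfun_mult[OF _ polyfun_const[of 0 c], of n F] by simp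

lemma polyfun_diff: "polyfun n F \<Longrightarrow> polyfun n G \<Longrightarrow> polyfun n (\<lambda>t. F t - G t)"
  using polyfun_add[of n F "\<lambda>t. (-1) * G t"] polyfun_cmult[of n G "-1"] by simp

lemma polyfun_sum: "(\<And>i. i \<in> A \<Longrightarrow> polyfun n (F i)) \<Longrightarrow> polyfun n (\<lambda>t. \<Sum>i\<in>A. F i t)"
  by (induction A rule: infinite_finite_induct) (auto intro: polyfun_const polyfun_add)

lemma polyfun_power: "polyfun n F \<Longrightarrow> polyfun (k * n) (\<lambda>t. F t ^ k)"
  by (induction k) (auto intro: polyfun_const polyfun_mult)

lemma polyfun_cinner:
  "(\<And>i. polyfun n (\<lambda>t. x t $ i)) \<Longrightarrow> polyfun n (\<lambda>t. cinner (x t) w)"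
  unfolding cinner_def by (intro polyfun_sum polyfun_multc)

lemma polyfun_holomorphic: "polyfun n F \<Longrightarrow> F holomorphic_on S"
  unfolding polyfun_def by (auto intro: holomorphic_intros)

lemma polyfun_finite_zeros:
  assumes "polyfun n F" "F t \<noteq> 0" shows "finite {t. F t = 0}"
  using assms poly_roots_finite unfolding polyfun_def by (metis poly_0)

lemma polyfun_eq_infinite:
  assumes "polyfun m F" "polyfun n G" "infinite {t. F t = G t}"
  shows "F = G"
proof (rule ccontr)
  assume "F \<noteq> G"
  then obtain t where "F t \<noteq> G t" by auto
  moreover have "polyfun (max m n) (\<lambda>t. F t - G t)"
    using assms by (intro polyfun_diff) (auto intro: polyfun_mono)
  ultimately have "finite {t. F t - G t = 0}" using polyfun_finite_zeros by fastforce
  then show False using assms(3) by simp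
qed

lemma polyfun_eq_near_0:
  assumes "polyfun m F" "polyfun n G" "0 < e" "\<And>t. cmod t < e \<Longrightarrow> F t = G t"
  shows "F = G"
proof (rule polyfun_eq_infinite[OF assms(1,2)])
  have "ball 0 e \<subseteq> {t. F t = G t}" using assms(4) by auto
  moreover have "infinite (ball (0::complex) e)"
    using assms(3) uncountable_ball countable_finite by blast
  ultimately show "infinite {t. F t = G t}" using finite_subset by blast
qed

text \<open>
  A pole of order exactly \<open>d\<close> at \<open>1 / \<alpha>\<close> on one side forces a zero of order \<open>d\<close> of the
  denominator on the other side, and a polynomial of degree at most \<open>d\<close> with such a zero is known
  up to a constant.
\<close>

lemma polyfun_denominator:
  assumes R: "polyfun l R" and q: "polyfun d q" and S: "polyfun l' S"
    and eq: "\<And>t. R t * q t = S t * (1 - \<alpha> * t) ^ d"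
    and "\<alpha> \<noteq> 0" "R (1 / \<alpha>) \<noteq> 0" "q 0 = 1"
  shows "q t = (1 - \<alpha> * t) ^ d"
proof -
  obtain r where r: "R = poly r" using R by (auto simp: polyfun_def)
  obtain p where p: "degree p \<le> d" "q = poly p" using q by (auto simp: polyfun_def)
  obtain s where s: "S = poly s" using S by (auto simp: polyfun_def)
  define \<beta> where "\<beta> = 1 / \<alpha>"
  have D: "1 - \<alpha> * t = - \<alpha> * poly [:-\<beta>, 1:] t" for t
    using \<open>\<alpha> \<noteq> 0\<close> by (simp add: \<beta>_def field_simps)
  have "poly (r * p) t = poly (smult ((-\<alpha>) ^ d) s * [:-\<beta>, 1:] ^ d) t" for t
    using eq[of t] unfolding r p s D power_mult_distrib by (simp add: mult_ac)
  then have rp: "r * p = smult ((-\<alpha>) ^ d) s * [:-\<beta>, 1:] ^ d"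
    using poly_eq_poly_eq_iff by blast
  have "p \<noteq> 0" "r \<noteq> 0" using \<open>q 0 = 1\<close> \<open>R (1 / \<alpha>) \<noteq> 0\<close> p(2) r by auto
  have "[:-\<beta>, 1:] ^ d dvd r * p" unfolding rp by (rule dvd_triv_right)
  then have "d \<le> order \<beta> (r * p)"
    using \<open>p \<noteq> 0\<close> \<open>r \<noteq> 0\<close> order_divides[of \<beta> d "r * p"] by simp
  also have "\<dots> = order \<beta> p"
    using \<open>p \<noteq> 0\<close> \<open>r \<noteq> 0\<close> order_mult[of r p \<beta>] order_0I[of r \<beta>] \<open>R (1 / \<alpha>) \<noteq> 0\<close>
    by (simp add: r \<beta>_def)
  finally have "[:-\<beta>, 1:] ^ d dvd p" by (simp add: order_divides)
  then obtain k where k: "p = [:-\<beta>, 1:] ^ d * k" by auto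
  then have "k \<noteq> 0" using \<open>p \<noteq> 0\<close> by auto
  then have "degree p = d + degree k"
    unfolding k by (subst degree_mult_eq) (auto simp: degree_linear_power)
  then have "degree k = 0" using p(1) by simp
  then obtain c where c: "k = [:c:]" by (rule degree_eq_zeroE)
  have qt: "q t = c * (t - \<beta>) ^ d" for t
    by (simp add: p(2) k c)
  have "c * (- \<beta>) ^ d = 1" using \<open>q 0 = 1\<close> qt[of 0] by simp
  moreover have "(- \<beta>) ^ d * (- \<alpha>) ^ d = 1"
    using \<open>\<alpha> \<noteq> 0\<close> by (simp add: \<beta>_def flip: power_mult_distrib)
  ultimately have "c = (- \<alpha>) ^ d"
    by (metis mult.assoc mult_1 mult_1_right)
  then show ?thesis
    unfolding qt D power_mult_distrib by simp
qed

text \<open>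
  Multiplication by a nonconstant polynomial would raise the degree above \<open>e\<close>; the hypothesis
  \<open>c e \<noteq> 0\<close> says that the first factor already has degree \<open>e\<close>.
\<close>

lemma polyfun_constant_factor:
  assumes R: "\<And>t. R t = (\<Sum>j\<le>e. c j * t ^ j)" and "c e \<noteq> 0"
    and q: "polyfun d q" and S: "polyfun e S" and eq: "\<And>t. R t * q t = S t"
  shows "q t = q 0"
proof -
  define r where "r = (\<Sum>j\<le>e. monom (c j) j)"
  have r: "R t = poly r t" for t by (simp add: R r_def poly_sum poly_monom)
  have "coeff r e = c e" by (simp add: r_def coeff_sum)
  with \<open>c e \<noteq> 0\<close> have "e \<le> degree r" "r \<noteq> 0" by (auto intro: le_degree)
  obtain p where p: "q = poly p" using q by (auto simp: polyfun_def)
  obtain s where s: "degree s \<le> e" "S = poly s" using S by (auto simp: polyfun_def)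
  have "poly (r * p) = poly s" using eq r p s by auto
  then have "r * p = s" using poly_eq_poly_eq_iff by blast
  then have "p = 0 \<or> degree r + degree p \<le> e"
    using s(1) \<open>r \<noteq> 0\<close> degree_mult_eq by metis
  then have "degree p = 0" using \<open>e \<le> degree r\<close> by auto
  then obtain a where "p = [:a:]" by (rule degree_eq_zeroE)
  then show ?thesis by (simp add: p)
qed

lemma polyfun_separate_degrees:
  assumes A: "polyfun d A" and "d < m" and B: "polyfun l B"
    and eq: "\<And>t. A t + t ^ m * B t = 0"
  shows "A t = 0" "B t = 0"
proof -
  obtain p where p: "degree p \<le> d" "A = poly p" using A by (auto simp: polyfun_def)
  obtain q where q: "B = poly q" using B by (auto simp: polyfun_def)
  have "poly (p + monom 1 m * q) t = poly 0 t" for t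
    using eq[of t] by (simp add: p q poly_monom)
  then have pq: "p + monom 1 m * q = 0" using poly_eq_poly_eq_iff by blast
  have "q = 0"
  proof (rule ccontr)
    assume "q \<noteq> 0"
    then have "degree (monom 1 m * q) = m + degree q"
      by (subst degree_mult_eq) (auto simp: degree_monom_eq)
    moreover have "monom 1 m * q = - p" using pq by (simp add: eq_neg_iff_add_eq_0 add.commute)
    ultimately show False using p(1) \<open>d < m\<close> by simp
  qed
  with pq show "A t = 0" "B t = 0" by (simp_all add: p q)
qed

section \<open>Homogeneous polynomials and homogeneous expansions\<close>

text \<open>
  Homogeneous polynomials as functions.  The zero function is admitted in every degree, so that
  sums and missing homogeneous parts need no case distinction.
\<close>

inductive hpoly :: "nat \<Rightarrow> ((complex, 'n::finite) vec \<Rightarrow> complex) \<Rightarrow> bool" where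
  zero: "hpoly d (\<lambda>_. 0)"
| const: "hpoly 0 (\<lambda>_. c)"
| coord: "hpoly 1 (\<lambda>z. z $ i)"
| add: "hpoly d F \<Longrightarrow> hpoly d G \<Longrightarrow> hpoly d (\<lambda>z. F z + G z)"
| mult: "hpoly d F \<Longrightarrow> hpoly e G \<Longrightarrow> hpoly (d + e) (\<lambda>z. F z * G z)"

lemma hpoly_cmult: "hpoly d F \<Longrightarrow> hpoly d (\<lambda>z. c * F z)"
  using hpoly.mult[OF hpoly.const[of c], of d F] by simp

lemma hpoly_sum: "(\<And>i. i \<in> A \<Longrightarrow> hpoly d (F i)) \<Longrightarrow> hpoly d (\<lambda>z. \<Sum>i\<in>A. F i z)"
  by (induction A rule: infinite_finite_induct) (auto intro: hpoly.intros)

lemma hpoly_power: "hpoly d F \<Longrightarrow> hpoly (k * d) (\<lambda>z. F z ^ k)"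
  by (induction k) (auto intro: hpoly.intros)

lemma hpoly_prod:
  "finite A \<Longrightarrow> (\<And>i. i \<in> A \<Longrightarrow> hpoly (d i) (F i)) \<Longrightarrow>
    hpoly (\<Sum>i\<in>A. d i) (\<lambda>z. \<Prod>i\<in>A. F i z)"
  by (induction A rule: finite_induct) (auto intro: hpoly.intros)

lemma hpoly_scale: "hpoly d F \<Longrightarrow> F (c *s z) = c ^ d * F z"
  by (induction rule: hpoly.induct) (auto simp: algebra_simps power_add)

lemma hpoly_polyfun:
  assumes "hpoly d F" "\<And>i. polyfun 1 (\<lambda>t. x t $ i)"
  shows "polyfun d (\<lambda>t. F (x t))"
  using assms(1)
  by (induction rule: hpoly.induct)
    (auto intro: polyfun_const polyfun_add polyfun_mult assms(2)[unfolded One_nat_def])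

definition homogeneous_expansion ::
    "nat \<Rightarrow> (nat \<Rightarrow> (complex, 'n::finite) vec \<Rightarrow> (complex, 'k::finite) vec)
      \<Rightarrow> ((complex, 'n) vec \<Rightarrow> (complex, 'k) vec) \<Rightarrow> bool" where
  "homogeneous_expansion d H h \<longleftrightarrow>
     (\<forall>j k. hpoly j (\<lambda>z. H j z $ k)) \<and> (\<forall>z. h z = (\<Sum>j\<le>d. H j z))"

lemma homogeneous_expansionD:
  assumes "homogeneous_expansion d H h"
  shows "hpoly j (\<lambda>z. H j z $ k)" "h z = (\<Sum>j\<le>d. H j z)"
    "H j (c *s z) = c ^ j *s H j z"
  using assms hpoly_scale[of j "\<lambda>z. H j z $ _" c z]
  unfolding homogeneous_expansion_def by (auto simp: vec_eq_iff)

lemma homogeneous_expansion_polyfun: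
  assumes h: "homogeneous_expansion d H h" and x: "\<And>i. polyfun 1 (\<lambda>t. x t $ i)"
  shows "polyfun d (\<lambda>t. h (x t) $ k)"
  unfolding homogeneous_expansionD(2)[OF h] sum_component
  by (intro polyfun_sum polyfun_mono[OF hpoly_polyfun[OF homogeneous_expansionD(1)[OF h] x]]) auto

lemma polyfun_line: "polyfun 1 (\<lambda>t. (x + t *s y) $ i)"
  using polyfun_add[OF polyfun_const polyfun_multc[OF polyfun_ident], of "x $ i" "y $ i"] by simp

lemma polyfun_line0: "polyfun 1 (\<lambda>t. (t *s y) $ i)"
  using polyfun_line[of 0 y i] by simp

text \<open>
  The degree bound of an expansion can be lowered to the true degree, without passing below a
  homogeneous part that is known to be nonzero.
\<close>

lemma homogeneous_expansion_leading:
  assumes h: "homogeneous_expansion D H h" and "H m x \<noteq> 0" "m \<le> D"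
  obtains d x where "m \<le> d" "d \<le> D" "homogeneous_expansion d H h" "H d x \<noteq> 0"
proof -
  define A where "A = {j. j \<le> D \<and> (\<exists>x. H j x \<noteq> 0)}"
  define d where "d = Max A"
  have A: "finite A" "m \<in> A" using assms(2,3) by (auto simp: A_def)
  then have "d \<in> A" "m \<le> d" unfolding d_def using Max_in by auto
  have z: "H j x = 0" if "j \<le> D" "\<not> j \<le> d" for j x
    using that Max_ge[OF A(1), of j] by (auto simp: A_def d_def)
  have "(\<Sum>j\<le>D. H j z) = (\<Sum>j\<le>d. H j z)" for z
    by (rule sum.mono_neutral_right) (use \<open>d \<in> A\<close> z in \<open>auto simp: A_def\<close>)
  then have "homogeneous_expansion d H h" using h by (simp add: homogeneous_expansion_def)
  with \<open>d \<in> A\<close> \<open>m \<le> d\<close> that show ?thesis by (auto simp: A_def)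
qed

text \<open>
  Distinct monomials are linearly independent as functions: they are distinct multiplicative
  characters, so Dedekind's argument applies.  Comparing the relation at \<open>z\<close> with the relation at
  the coordinatewise product \<open>y z\<close> eliminates one monomial; \<open>y\<close> has the value \<open>2\<close> at a coordinate
  in which two of the exponents differ and \<open>1\<close> elsewhere.
\<close>

definition monomial :: "('n::finite \<Rightarrow>\<^sub>0 nat) \<Rightarrow> (complex, 'n) vec \<Rightarrow> complex" where
  "monomial \<alpha> z = (\<Prod>i\<in>UNIV. z $ i ^ Poly_Mapping.lookup \<alpha> i)"

lemma monomials_independent:
  fixes c :: "('n::finite \<Rightarrow>\<^sub>0 nat) \<Rightarrow> complex"
  assumes "finite A" "\<And>z. (\<Sum>\<alpha>\<in>A. c \<alpha> * monomial \<alpha> z) = 0" "\<alpha> \<in> A"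
  shows "c \<alpha> = 0"
  using assms
proof (induction A arbitrary: c \<alpha> rule: finite_induct)
  case (insert \<beta> A)
  have mult: "monomial \<alpha> (\<chi> i. y $ i * z $ i) = monomial \<alpha> y * monomial \<alpha> z" for \<alpha> and y z :: "(complex, 'n) vec"
    by (simp add: monomial_def power_mult_distrib prod.distrib)
  have A0: "c \<alpha> = 0" if "\<alpha> \<in> A" for \<alpha>
  proof -
    have "\<alpha> \<noteq> \<beta>" using insert.hyps that by auto
    then obtain i where i: "Poly_Mapping.lookup \<alpha> i \<noteq> Poly_Mapping.lookup \<beta> i"
      by (meson poly_mapping_eqI)
    define y :: "(complex, 'n) vec" where "y = (\<chi> j. if j = i then 2 else 1)"
    have y: "monomial \<delta> y = 2 ^ Poly_Mapping.lookup \<delta> i" for \<delta>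
      unfolding monomial_def y_def by (simp add: if_distrib[of "\<lambda>x. x ^ _"] cong: if_cong)
    have "(\<Sum>\<delta>\<in>A. c \<delta> * (monomial \<delta> y - monomial \<beta> y) * monomial \<delta> z) = 0" for z
    proof -
      have "(\<Sum>\<delta>\<in>insert \<beta> A. c \<delta> * (monomial \<delta> y - monomial \<beta> y) * monomial \<delta> z)
          = (\<Sum>\<delta>\<in>insert \<beta> A. c \<delta> * monomial \<delta> (\<chi> i. y $ i * z $ i))
            - monomial \<beta> y * (\<Sum>\<delta>\<in>insert \<beta> A. c \<delta> * monomial \<delta> z)"
        unfolding sum_distrib_left sum_subtractf[symmetric] mult
        by (intro sum.cong refl) (simp add: algebra_simps)
      then show ?thesis using insert.prems(1) insert.hyps by simp
    qed
    then have "c \<alpha> * (monomial \<alpha> y - monomial \<beta> y) = 0"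
      by (rule insert.IH[of "\<lambda>\<delta>. c \<delta> * (monomial \<delta> y - monomial \<beta> y)"]) (rule that)
    moreover have "(2::complex) ^ Poly_Mapping.lookup \<alpha> i \<noteq> 2 ^ Poly_Mapping.lookup \<beta> i"
    proof
      assume "(2::complex) ^ Poly_Mapping.lookup \<alpha> i = 2 ^ Poly_Mapping.lookup \<beta> i"
      then have "norm ((2::complex) ^ Poly_Mapping.lookup \<alpha> i) = norm ((2::complex) ^ Poly_Mapping.lookup \<beta> i)"
        by simp
      then show False using i by (simp add: norm_power)
    qed
    ultimately show ?thesis unfolding y by simp
  qed
  have "c \<beta> = 0"
  proof -
    have "c \<beta> * monomial \<beta> 1 + (\<Sum>\<delta>\<in>A. c \<delta> * monomial \<delta> 1) = 0"
      using insert.prems(1)[of 1] insert.hyps by simp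
    moreover have "monomial \<beta> (1 :: (complex, 'n) vec) = 1" by (simp add: monomial_def)
    ultimately show ?thesis using A0 by simp
  qed
  with A0 insert.prems(2) show ?case by auto
qed simp

lemma polynomial_map_expansion:
  fixes P :: "('n::finite cpoly, 'k::finite) vec"
  obtains H where "homogeneous_expansion (polynomial_map_degree P) H (polynomial_map P)"
    "polynomial_map_degree P > 0 \<Longrightarrow> \<exists>x. H (polynomial_map_degree P) x \<noteq> 0"
proof -
  define size :: "('n \<Rightarrow>\<^sub>0 nat) \<Rightarrow> nat" where "size \<alpha> = (\<Sum>i\<in>UNIV. Poly_Mapping.lookup \<alpha> i)" for \<alpha>
  define D where "D = polynomial_map_degree P"
  define K where "K k j = {\<alpha> \<in> Poly_Mapping.keys (P $ k). size \<alpha> = j}" for k j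
  define H where "H j z = (\<chi> k. \<Sum>\<alpha>\<in>K k j. Poly_Mapping.lookup (P $ k) \<alpha> * monomial \<alpha> z)" for j z
  have deg: "size \<alpha> \<le> D" if "\<alpha> \<in> Poly_Mapping.keys (P $ k)" for \<alpha> k
  proof -
    have "size \<alpha> \<le> cpoly_degree (P $ k)"
      unfolding cpoly_degree_def size_def using that by (intro Max_ge) auto
    also have "\<dots> \<le> D" unfolding D_def polynomial_map_degree_def by (intro Max_ge) auto
    finally show ?thesis .
  qed
  have "hpoly (size \<alpha>) (monomial \<alpha>)" for \<alpha>
    using hpoly_prod[OF _ hpoly_power[OF hpoly.coord], of UNIV "Poly_Mapping.lookup \<alpha>" "\<lambda>i. i"]
    unfolding size_def monomial_def by simp
  then have "hpoly j (\<lambda>z. H j z $ k)" for j k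
    unfolding H_def by (auto intro!: hpoly_sum hpoly_cmult simp: K_def)
  moreover have "polynomial_map P z = (\<Sum>j\<le>D. H j z)" for z
  proof -
    have "cpoly_eval (P $ k) z
        = (\<Sum>j\<le>D. \<Sum>\<alpha>\<in>K k j. Poly_Mapping.lookup (P $ k) \<alpha> * monomial \<alpha> z)" for k
      unfolding cpoly_eval_def monomial_def K_def
      by (rule sum.group[symmetric]) (use deg in auto)
    then show ?thesis by (simp add: vec_eq_iff polynomial_map_def H_def)
  qed
  moreover have "\<exists>x. H D x \<noteq> 0" if pos: "D > 0"
  proof (rule ccontr)
    assume "\<nexists>x. H D x \<noteq> 0"
    then have z: "(\<Sum>\<alpha>\<in>K k D. Poly_Mapping.lookup (P $ k) \<alpha> * monomial \<alpha> x) = 0" for k x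
    proof -
      have "H D x $ k = 0" using \<open>\<nexists>x. H D x \<noteq> 0\<close> by simp
      then show ?thesis by (simp add: H_def)
    qed
    have "D \<in> range (\<lambda>k. cpoly_degree (P $ k))"
      unfolding D_def polynomial_map_degree_def by (intro Max_in) auto
    then obtain k where "cpoly_degree (P $ k) = D" by auto
    moreover have "cpoly_degree (P $ k) \<in> insert 0 (size ` Poly_Mapping.keys (P $ k))"
      unfolding cpoly_degree_def size_def[abs_def] by (intro Max_in) auto
    ultimately obtain \<alpha> where "\<alpha> \<in> K k D" using pos by (auto simp: K_def)
    then have "Poly_Mapping.lookup (P $ k) \<alpha> = 0"
      by (intro monomials_independent[OF _ z]) (auto simp: K_def)
    with \<open>\<alpha> \<in> K k D\<close> show False by (simp add: K_def in_keys_iff)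
  qed
  ultimately show ?thesis
    by (intro that[of H]) (simp_all add: homogeneous_expansion_def D_def)
qed

section \<open>Hermitian symmetries of polynomial maps\<close>

text \<open>
  The homogenization of \<open>h\<close>, evaluated along a curve in homogeneous coordinates \<open>(\<tau>, x)\<close>: it is
  polynomial, clears the denominators of \<open>h (x / \<tau>)\<close>, and at infinity it is the leading part.
\<close>

lemma homogenization_polyfun:
  assumes h: "homogeneous_expansion d H h"
    and x: "\<And>i. polyfun 1 (\<lambda>t. x t $ i)" and \<tau>: "polyfun 1 \<tau>"
  shows "polyfun d (\<lambda>t. \<Sum>j\<le>d. \<tau> t ^ (d - j) * H j (x t) $ k)"
proof (rule polyfun_sum)
  fix j assume "j \<in> {..d}"
  then show "polyfun d (\<lambda>t. \<tau> t ^ (d - j) * H j (x t) $ k)"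
    using polyfun_mult[OF polyfun_power[OF \<tau>, of "d - j"]
        hpoly_polyfun[OF homogeneous_expansionD(1)[OF h, of j k] x]]
    by simp
qed

lemma homogenization_finite:
  assumes h: "homogeneous_expansion d H h" and "\<tau> \<noteq> 0"
  shows "(\<Sum>j\<le>d. \<tau> ^ (d - j) * H j x $ k) = \<tau> ^ d * h ((1 / \<tau>) *s x) $ k"
  unfolding homogeneous_expansionD(2)[OF h] sum_component sum_distrib_left homogeneous_expansionD(3)[OF h]
proof (rule sum.cong)
  fix j assume "j \<in> {..d}"
  then have "\<tau> ^ d = \<tau> ^ (d - j) * \<tau> ^ j" by (simp flip: power_add)
  then show "\<tau> ^ (d - j) * H j x $ k = \<tau> ^ d * ((1 / \<tau>) ^ j *s H j x) $ k"
    using \<open>\<tau> \<noteq> 0\<close> by (simp add: power_one_over)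
qed simp

lemma homogenization_at_infinity:
  "(\<Sum>j\<le>d. (0::complex) ^ (d - j) * H j x $ k) = H d x $ k"
  by (subst sum.remove[of _ d]) (auto intro!: sum.neutral)

lemma polyfun_unitary_line:
  assumes "unitary_map V"
  shows "polyfun 1 (\<lambda>t. V (x + t *s y) $ i)"
  unfolding unitary_map_add[OF assms] unitary_map_scale[OF assms] by (rule polyfun_line)

lemma polyfun_involution_numerator:
  assumes W: "unitary_map W" and x: "\<And>i. polyfun n (\<lambda>t. x t $ i)"
  shows "polyfun n (\<lambda>t. W (b - involution_part b (x t)) $ k)"
proof -
  have c: "W u $ k = cinner u (inv W (axis k 1))" for u
  proof -
    have "W (inv W (axis k 1)) = axis k 1"
      by (meson W bij_is_surj surj_f_inv_f unitary_map_bij)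
    then have "cinner u (inv W (axis k 1)) = cinner (W u) (axis k 1)"
      by (metis W unitary_map_cinner)
    also have "\<dots> = W u $ k"
      unfolding cinner_def axis_def by (simp add: if_distrib[of cnj] if_distrib[of "\<lambda>x. _ * x"] cong: if_cong)
    finally show ?thesis by simp
  qed
  have x1: "polyfun n (\<lambda>t. involution_part b (x t) $ i)" for i
    unfolding involution_part_def vector_add_component vector_smult_component
    by (intro polyfun_add polyfun_cmult x polyfun_multc)
      (simp add: divide_inverse polyfun_multc polyfun_cinner x)
  show ?thesis
    unfolding c
    by (rule polyfun_cinner) (simp add: polyfun_diff polyfun_const x1)
qed

text \<open>
  Write \<open>\<gamma> = V \<circ> \<phi>\<^sub>a\<close> and \<open>\<psi> = W \<circ> \<phi>\<^sub>b\<close>.  Along the line \<open>t v\<close> the map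
  \<open>h \<circ> \<gamma>\<close> has a pole of order exactly \<open>d\<close> where \<open>\<langle>t v, a\<rangle> = 1\<close>, because \<open>\<gamma>\<close> maps this point to a
  point at infinity at which the leading part of \<open>h\<close> does not vanish.  The denominator of
  \<open>\<psi> \<circ> h\<close> is \<open>1 - \<langle>h, b\<rangle>\<close>, which has degree at most \<open>d\<close>.
\<close>

lemma denominator_identity_on_line:
  fixes h :: "(complex, 'n::finite) vec \<Rightarrow> (complex, 'k::finite) vec"
  assumes h: "homogeneous_expansion d H h" and h0: "h 0 = 0"
    and ball: "\<And>z. norm z < 1 \<Longrightarrow> norm (h z) < 1"
    and a: "norm a < 1" and V: "unitary_map V" and b: "norm b < 1" and W: "unitary_map W"
    and eq: "\<And>z. norm z < 1 \<Longrightarrow> h (V (ball_involution a z)) = W (ball_involution b (h z))"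
    and va: "cinner v a \<noteq> 0" and lead: "H d (V (cinner v a *s a - involution_part a v)) \<noteq> 0"
  shows "1 - cinner (h v) b = (1 - cinner v a) ^ d"
proof -
  define \<alpha> where "\<alpha> = cinner v a"
  define q where "q t = 1 - cinner (h (t *s v)) b" for t
  define \<tau> where "\<tau> t = 1 - \<alpha> * t" for t
  define X where "X t = V (a + t *s (- involution_part a v))" for t
  have q: "polyfun d q"
    unfolding q_def
    by (intro polyfun_diff polyfun_const polyfun_cinner homogeneous_expansion_polyfun[OF h] polyfun_line0)
  have \<tau>: "polyfun 1 \<tau>"
    unfolding \<tau>_def by (intro polyfun_diff polyfun_const polyfun_cmult polyfun_ident)
  have X: "polyfun 1 (\<lambda>t. X t $ i)" for i
    unfolding X_def by (rule polyfun_unitary_line[OF V])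
  obtain k where k: "H d (V (\<alpha> *s a - involution_part a v)) $ k \<noteq> 0"
    using lead unfolding \<alpha>_def by (metis vec_eq_iff zero_index)
  define R where "R t = (\<Sum>j\<le>d. \<tau> t ^ (d - j) * H j (X t) $ k)" for t
  define S where "S t = W (b - involution_part b (h (t *s v))) $ k" for t
  have R: "polyfun d R" unfolding R_def by (rule homogenization_polyfun[OF h X \<tau>])
  have S: "polyfun d S"
    unfolding S_def
    by (intro polyfun_involution_numerator[OF W] homogeneous_expansion_polyfun[OF h] polyfun_line0)
  have "(\<lambda>t. R t * q t) = (\<lambda>t. S t * \<tau> t ^ d)"
  proof (rule polyfun_eq_near_0)
    show "polyfun (d + d) (\<lambda>t. R t * q t)" by (rule polyfun_mult[OF R q])
    show "polyfun (d + d * 1) (\<lambda>t. S t * \<tau> t ^ d)" by (rule polyfun_mult[OF S polyfun_power[OF \<tau>]])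
    show "0 < 1 / (1 + norm v)" by (simp add: add_pos_nonneg)
    fix t assume "cmod t < 1 / (1 + norm v)"
    then have "cmod t * (1 + norm v) < 1"
      by (simp add: pos_less_divide_eq add_pos_nonneg)
    then have tv: "norm (t *s v) < 1"
      unfolding norm_scale distrib_left using norm_ge_zero[of t] by linarith
    have \<tau>t: "\<tau> t = 1 - cinner (t *s v) a" by (simp add: \<tau>_def \<alpha>_def cinner_scale_left)
    then have "\<tau> t \<noteq> 0" using one_minus_cinner_nonzero[OF tv a] by simp
    have "q t \<noteq> 0" unfolding q_def by (rule one_minus_cinner_nonzero[OF ball[OF tv] b])
    have "V (ball_involution a (t *s v)) = (1 / \<tau> t) *s X t"
      unfolding X_def ball_involution_def \<tau>t[symmetric] unitary_map_scale[OF V]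
        vec.linear_scale[OF involution_part_linear]
      by simp
    then have "R t = \<tau> t ^ d * W (ball_involution b (h (t *s v))) $ k"
      unfolding R_def homogenization_finite[OF h \<open>\<tau> t \<noteq> 0\<close>] using eq[OF tv] by simp
    also have "W (ball_involution b (h (t *s v))) $ k = S t / q t"
      unfolding ball_involution_def S_def q_def[symmetric] unitary_map_scale[OF W] by simp
    finally show "R t * q t = S t * \<tau> t ^ d" using \<open>q t \<noteq> 0\<close> by simp
  qed
  then have RS: "R t * q t = S t * \<tau> t ^ d" for t by (rule fun_cong)
  have "q 1 = (1 - \<alpha> * 1) ^ d"
  proof (rule polyfun_denominator[OF R q S])
    show "R t * q t = S t * (1 - \<alpha> * t) ^ d" for t using RS by (simp add: \<tau>_def)
    show "\<alpha> \<noteq> 0" using va by (simp add: \<alpha>_def)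
    have "X (1 / \<alpha>) = (1 / \<alpha>) *s V (\<alpha> *s a - involution_part a v)"
      unfolding X_def unitary_map_scale[OF V, symmetric]
      using \<open>\<alpha> \<noteq> 0\<close> by (intro arg_cong[of _ _ V]) (simp add: vec_eq_iff right_diff_distrib)
    moreover have "\<tau> (1 / \<alpha>) = 0" using \<open>\<alpha> \<noteq> 0\<close> by (simp add: \<tau>_def)
    then have "R (1 / \<alpha>) = H d (X (1 / \<alpha>)) $ k"
      unfolding R_def by (simp only: homogenization_at_infinity)
    ultimately have "R (1 / \<alpha>) = (1 / \<alpha>) ^ d * H d (V (\<alpha> *s a - involution_part a v)) $ k"
      by (simp only: homogeneous_expansionD(3)[OF h] vector_smult_component)
    then show "R (1 / \<alpha>) \<noteq> 0" using k \<open>\<alpha> \<noteq> 0\<close> by simp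
    show "q 0 = 1" by (simp add: q_def h0)
  qed
  then show ?thesis by (simp add: q_def \<alpha>_def)
qed

text \<open>
  The previous identity holds for generic \<open>v\<close>, and it extends to \<open>v = a\<close> along a line through \<open>a\<close>.
  That its condition on the leading part is generic needs an argument: the linear map that sends
  \<open>v\<close> to the image at infinity of the pole on the line of \<open>v\<close> is injective, hence surjective, so
  the leading part does not vanish identically on its range.
\<close>

lemma denominator_identity_at_centre:
  fixes h :: "(complex, 'n::finite) vec \<Rightarrow> (complex, 'k::finite) vec"
  assumes h: "homogeneous_expansion d H h" and h0: "h 0 = 0" and top: "H d x0 \<noteq> 0"
    and ball: "\<And>z. norm z < 1 \<Longrightarrow> norm (h z) < 1"
    and a: "norm a < 1" "a \<noteq> 0" and V: "unitary_map V" and b: "norm b < 1" and W: "unitary_map W"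
    and eq: "\<And>z. norm z < 1 \<Longrightarrow> h (V (ball_involution a z)) = W (ball_involution b (h z))"
  shows "1 - cinner (h a) b = (1 - cinner a a) ^ d"
proof -
  \<comment> \<open>\<open>V (T v)\<close> spans the direction at infinity to which \<open>\<gamma>\<close> maps the pole on the line of \<open>v\<close>.\<close>
  define T where "T v = cinner v a *s a - involution_part a v" for v
  have lin: "Vector_Spaces.linear (*s) (*s) T"
  proof -
    have "T (x + y) = T x + T y" for x y
      unfolding T_def vec.linear_add[OF involution_part_linear] cinner_add_left
      by (simp add: vec_eq_iff distrib_right)
    moreover have "T (c *s x) = c *s T x" for c x
      unfolding T_def vec.linear_scale[OF involution_part_linear] cinner_scale_left
      by (simp add: vec_eq_iff right_diff_distrib)
    ultimately show ?thesis
      unfolding Vector_Spaces.linear_iff using vec.vector_space_axioms by blast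
  qed
  have "v = 0" if "T v = 0" for v
  proof -
    have e: "involution_part a v = cinner v a *s a" using that by (simp add: T_def)
    then have "involution_part a (involution_part a v) = cinner v a *s a"
      by (simp add: vec.linear_scale[OF involution_part_linear] involution_part_cinner[OF a(1)])
    then have "(ball_radical a)\<^sup>2 *s v = 0"
      by (simp add: involution_part_cinner[OF a(1)])
    then show "v = 0" using ball_radical(4)[OF a(1)] by (simp only: vec.scale_eq_0_iff) simp
  qed
  then have "inj T" using vec.linear_inj_iff_eq_0[OF lin] by blast
  then have "surj T" using vec.linear_inj_imp_surj[OF lin] by blast
  moreover have "surj V" using unitary_map_bij[OF V] bij_is_surj by blast
  ultimately obtain u where u: "V (T u) = x0" by (metis surjD)
  define v where "v t = a + t *s (u - a)" for t
  have v: "polyfun 1 (\<lambda>t. v t $ i)" for i unfolding v_def by (rule polyfun_line)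
  have VT: "V (T (v t)) = V (T a) + t *s (V (T (u - a)))" for t
    unfolding v_def vec.linear_add[OF lin] vec.linear_scale[OF lin]
      unitary_map_add[OF V] unitary_map_scale[OF V] ..
  obtain k where k: "H d x0 $ k \<noteq> 0" using top by (metis vec_eq_iff zero_index)
  define F where "F t = cinner (v t) a" for t
  define G where "G t = H d (V (T (v t))) $ k" for t
  have F: "polyfun 1 F" unfolding F_def by (rule polyfun_cinner[OF v])
  have G: "polyfun d G"
    unfolding G_def VT by (rule hpoly_polyfun[OF homogeneous_expansionD(1)[OF h] polyfun_line])
  have "F 0 \<noteq> 0" using a(2) by (simp add: F_def v_def cinner_self)
  have "G 1 \<noteq> 0" using k u by (simp add: G_def v_def)
  have fin: "finite ({t. F t = 0} \<union> {t. G t = 0})"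
    using polyfun_finite_zeros[OF F \<open>F 0 \<noteq> 0\<close>] polyfun_finite_zeros[OF G \<open>G 1 \<noteq> 0\<close>] by simp
  have "(\<lambda>t. 1 - cinner (h (v t)) b) = (\<lambda>t. (1 - cinner (v t) a) ^ d)"
  proof (rule polyfun_eq_infinite)
    show "polyfun d (\<lambda>t. 1 - cinner (h (v t)) b)"
      by (intro polyfun_diff polyfun_const polyfun_cinner homogeneous_expansion_polyfun[OF h] v)
    show "polyfun (d * 1) (\<lambda>t. (1 - cinner (v t) a) ^ d)"
      by (intro polyfun_power polyfun_diff polyfun_const polyfun_cinner v)
    have "- ({t. F t = 0} \<union> {t. G t = 0})
        \<subseteq> {t. 1 - cinner (h (v t)) b = (1 - cinner (v t) a) ^ d}"
    proof
      fix t assume "t \<in> - ({t. F t = 0} \<union> {t. G t = 0})"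
      then have "cinner (v t) a \<noteq> 0" "H d (V (T (v t))) \<noteq> 0" by (auto simp: F_def G_def)
      then show "t \<in> {t. 1 - cinner (h (v t)) b = (1 - cinner (v t) a) ^ d}"
        using denominator_identity_on_line[OF h h0 ball a(1) V b W eq] unfolding T_def by blast
    qed
    moreover have "infinite (- ({t. F t = 0} \<union> {t. G t = 0}))"
      unfolding finite_compl[OF fin] by (rule infinite_UNIV_char_0)
    ultimately show "infinite {t. 1 - cinner (h (v t)) b = (1 - cinner (v t) a) ^ d}"
      using finite_subset by blast
  qed
  from fun_cong[OF this, of 0] show ?thesis by (simp add: v_def)
qed

lemma homogeneous_expansion_Schwarz:
  assumes h: "homogeneous_expansion d H h" and h0: "h 0 = 0"
    and ball: "\<And>z. norm z < 1 \<Longrightarrow> norm (h z) < 1" and z: "norm z < 1"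
  shows "norm (h z) \<le> norm z"
proof (rule Schwarz_ball(1)[where G = h, OF _ ball h0 z])
  show "(\<lambda>t. h (t *s v) $ i) holomorphic_on ball 0 1" for v i
    by (rule polyfun_holomorphic[OF homogeneous_expansion_polyfun[OF h polyfun_line0]])
qed

text \<open>
  By the previous identity, the function \<open>(1 - |h|\<^sup>2) / (1 - |z|\<^sup>2) ^ d\<close> is invariant under \<open>\<gamma>\<close> up to a
  constant factor.  It is \<open>1\<close> at the origin, and by the Schwarz lemma it is
  at least \<open>(1 - |z|\<^sup>2) ^ (1 - d)\<close>, hence larger than \<open>1\<close> elsewhere because \<open>d \<ge> 2\<close>; so \<open>\<gamma>\<close> fixes the unique
  minimum point \<open>0\<close>.  The calculation evaluates this at \<open>0\<close> and at \<open>\<gamma>\<^sup>-\<^sup>1 0\<close> only.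
\<close>

theorem hermitian_symmetry_fixes_0:
  fixes h :: "(complex, 'n::finite) vec \<Rightarrow> (complex, 'k::finite) vec"
  assumes h: "homogeneous_expansion d H h" and h0: "h 0 = 0" and top: "H d x0 \<noteq> 0" and "d \<ge> 2"
    and ball: "\<And>z. norm z < 1 \<Longrightarrow> norm (h z) < 1"
    and \<gamma>: "\<gamma> \<in> ball_automorphisms" and \<psi>: "\<psi> \<in> ball_automorphisms"
    and eq: "\<And>z. norm z < 1 \<Longrightarrow> h (\<gamma> z) = \<psi> (h z)"
  shows "\<gamma> 0 = 0"
proof -
  obtain a V where a: "norm a < 1" and V: "unitary_map V"
    and \<gamma>': "\<And>z. norm z < 1 \<Longrightarrow> \<gamma> z = V (ball_involution a z)"
    using ball_automorphism_decomposition[OF \<gamma>] by blast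
  obtain b W where b: "norm b < 1" and W: "unitary_map W"
    and \<psi>': "\<And>z. norm z < 1 \<Longrightarrow> \<psi> z = W (ball_involution b z)"
    using ball_automorphism_decomposition[OF \<psi>] by blast
  have \<gamma>0: "\<gamma> 0 = V a" "\<gamma> a = 0"
    using \<gamma>'[of 0] \<gamma>'[OF a] a V
    by (simp_all add: ball_involution_0 ball_involution_self unitary_map_zero)
  have eq': "h (V (ball_involution a z)) = W (ball_involution b (h z))" if "norm z < 1" for z
    using eq[OF that] \<gamma>'[OF that] \<psi>'[OF ball[OF that]] by simp
  have law: "1 - (norm (h (\<gamma> z)))\<^sup>2
      = (1 - (norm b)\<^sup>2) * (1 - (norm (h z))\<^sup>2) / (cmod (1 - cinner (h z) b))\<^sup>2"
    if "norm z < 1" for z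
    using eq[OF that] \<psi>'[OF ball[OF that]] one_minus_norm_involution[OF b ball[OF that]]
      unitary_map_norm[OF W] by simp
  have Schwarz: "(norm (h z))\<^sup>2 \<le> (norm z)\<^sup>2" if "norm z < 1" for z
    using homogeneous_expansion_Schwarz[OF h h0 ball that] by (simp add: power_mono)
  have "a = 0"
  proof (rule ccontr)
    assume "a \<noteq> 0"
    define A where "A = 1 - (norm a)\<^sup>2"
    have A: "0 < A" "A < 1"
      using a \<open>a \<noteq> 0\<close> by (simp_all add: A_def abs_square_less_1)
    have "1 - cinner (h a) b = of_real A ^ d"
      using denominator_identity_at_centre[OF h h0 top ball a \<open>a \<noteq> 0\<close> V b W eq']
      by (simp add: A_def cinner_self)
    then have "cmod (1 - cinner (h a) b) = A ^ d" using A by (simp add: norm_power)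
    then have "(A ^ d)\<^sup>2 = (1 - (norm b)\<^sup>2) * (1 - (norm (h a))\<^sup>2)"
      using law[OF a] A by (simp add: \<gamma>0 h0 field_simps)
    also have "\<dots> \<ge> A * A"
    proof (rule mult_mono)
      have "norm (\<gamma> 0) < 1" using a by (simp add: \<gamma>0 unitary_map_norm[OF V])
      then have "(norm (h (\<gamma> 0)))\<^sup>2 \<le> (norm a)\<^sup>2"
        using Schwarz by (metis \<gamma>0(1) unitary_map_norm[OF V])
      then show "A \<le> 1 - (norm b)\<^sup>2"
        using law[of 0] by (simp add: h0 A_def)
      show "A \<le> 1 - (norm (h a))\<^sup>2" using Schwarz[OF a] by (simp add: A_def)
      then show "0 \<le> 1 - (norm b)\<^sup>2" "0 \<le> A" using A b by (simp_all add: abs_square_le_1)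
    qed
    finally have "A * A \<le> A ^ (2 * d)" by (simp add: power_mult[symmetric] mult.commute)
    moreover have "A ^ (2 * d) \<le> A ^ 4"
      using A \<open>d \<ge> 2\<close> by (intro power_decreasing) auto
    moreover have "A ^ 4 < A ^ 2" using A by (intro power_strict_decreasing) auto
    ultimately show False by (simp add: power2_eq_square)
  qed
  then show ?thesis using V by (simp add: \<gamma>0(1) unitary_map_zero)
qed

text \<open>
  For unitary \<open>V\<close>, the map \<open>h \<circ> V\<close> is a polynomial map of the same degree as \<open>h\<close>, so the
  denominator \<open>1 - \<langle>h, b\<rangle>\<close> of \<open>\<psi> \<circ> h\<close> must be constant, and
  evaluation at \<open>0 = V 0\<close> shows that the constant factor between the Hermitian
  forms of \<open>h \<circ> V\<close> and \<open>h\<close> is \<open>1\<close>.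
\<close>

lemma hermitian_symmetry_gram:
  fixes h :: "(complex, 'n::finite) vec \<Rightarrow> (complex, 'k::finite) vec"
  assumes h: "homogeneous_expansion D H h"
    and ball: "\<And>z. norm z < 1 \<Longrightarrow> norm (h z) < 1"
    and V: "unitary_map V" and \<psi>: "\<psi> \<in> ball_automorphisms"
    and eq: "\<And>z. norm z < 1 \<Longrightarrow> h (V z) = \<psi> (h z)"
    and z: "norm z < 1" and w: "norm w < 1"
  shows "cinner (h (V z)) (h (V w)) = cinner (h z) (h w)"
proof -
  obtain b W where b: "norm b < 1" and W: "unitary_map W"
    and \<psi>': "\<And>z. norm z < 1 \<Longrightarrow> \<psi> z = W (ball_involution b z)"
    using ball_automorphism_decomposition[OF \<psi>] by blast
  have const: "cinner (h v) b = cinner (h 0) b" for v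
  proof (cases "\<exists>j\<le>D. \<exists>x. H j x \<noteq> 0")
    case False
    then show ?thesis unfolding homogeneous_expansionD(2)[OF h] by simp
  next
    case True
    then obtain d x0 where hd: "homogeneous_expansion d H h" and top: "H d x0 \<noteq> 0"
      using homogeneous_expansion_leading[OF h] by metis
    obtain k where k: "H d x0 $ k \<noteq> 0" using top by (metis vec_eq_iff zero_index)
    have "surj V" using unitary_map_bij[OF V] bij_is_surj by blast
    then obtain u where u: "V u = x0" by (metis surjD)
    have line: "cinner (h v) b = cinner (h 0) b" if "H d (V v) $ k \<noteq> 0" for v
    proof -
      define q where "q t = 1 - cinner (h (t *s v)) b" for t
      define R where "R t = h (V (t *s v)) $ k" for t
      define S where "S t = W (b - involution_part b (h (t *s v))) $ k" for t
      have q: "polyfun d q"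
        unfolding q_def
        by (intro polyfun_diff polyfun_const polyfun_cinner homogeneous_expansion_polyfun[OF hd] polyfun_line0)
      have S: "polyfun d S"
        unfolding S_def
        by (intro polyfun_involution_numerator[OF W] homogeneous_expansion_polyfun[OF hd] polyfun_line0)
      have R: "R t = (\<Sum>j\<le>d. H j (V v) $ k * t ^ j)" for t
        unfolding R_def unitary_map_scale[OF V] homogeneous_expansionD(2)[OF hd] sum_component
          homogeneous_expansionD(3)[OF hd]
        by (simp add: mult.commute)
      have R': "polyfun d R"
        unfolding R_def unitary_map_scale[OF V]
        by (rule homogeneous_expansion_polyfun[OF hd polyfun_line0])
      have "(\<lambda>t. R t * q t) = S"
      proof (rule polyfun_eq_near_0[OF polyfun_mult[OF R' q] S])
        show "0 < 1 / (1 + norm v)" by (simp add: add_pos_nonneg)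
        fix t assume "cmod t < 1 / (1 + norm v)"
        then have "cmod t * (1 + norm v) < 1"
          by (simp add: pos_less_divide_eq add_pos_nonneg)
        then have tv: "norm (t *s v) < 1"
          unfolding norm_scale distrib_left using norm_ge_zero[of t] by linarith
        have "q t \<noteq> 0" unfolding q_def by (rule one_minus_cinner_nonzero[OF ball[OF tv] b])
        have "R t = W (ball_involution b (h (t *s v))) $ k"
          unfolding R_def using eq[OF tv] \<psi>'[OF ball[OF tv]] by simp
        also have "\<dots> = S t / q t"
          unfolding ball_involution_def S_def q_def[symmetric] unitary_map_scale[OF W] by simp
        finally show "R t * q t = S t" using \<open>q t \<noteq> 0\<close> by simp
      qed
      then have RS: "R t * q t = S t" for t by (rule fun_cong)
      have "q 1 = q 0" by (rule polyfun_constant_factor[OF R that q S RS])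
      then show ?thesis by (simp add: q_def)
    qed
    define y where "y t = v + t *s (u - v)" for t
    define F where "F t = H d (V (y t)) $ k" for t
    have F: "polyfun d F"
      unfolding F_def y_def
      by (rule hpoly_polyfun[OF homogeneous_expansionD(1)[OF h] polyfun_unitary_line[OF V]])
    have "F 1 \<noteq> 0" using k u by (simp add: F_def y_def)
    have "(\<lambda>t. cinner (h (y t)) b) = (\<lambda>t. cinner (h 0) b)"
    proof (rule polyfun_eq_infinite)
      show "polyfun d (\<lambda>t. cinner (h (y t)) b)"
        unfolding y_def
        by (intro polyfun_cinner homogeneous_expansion_polyfun[OF hd] polyfun_line)
      show "polyfun 0 (\<lambda>t. cinner (h 0) b)" by (rule polyfun_const)
      have "- {t. F t = 0} \<subseteq> {t. cinner (h (y t)) b = cinner (h 0) b}"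
        using line by (auto simp: F_def)
      moreover have "infinite (- {t. F t = 0})"
        unfolding finite_compl[OF polyfun_finite_zeros[OF F \<open>F 1 \<noteq> 0\<close>]]
        by (rule infinite_UNIV_char_0)
      ultimately show "infinite {t. cinner (h (y t)) b = cinner (h 0) b}"
        using finite_subset by blast
    qed
    from fun_cong[OF this, of 0] show ?thesis by (simp add: y_def)
  qed
  \<comment> \<open>Since \<open>\<langle>h, b\<rangle>\<close> is constant, the transformation law for \<open>\<psi>\<close> has a constant factor.\<close>
  define \<kappa> where "\<kappa> = 1 - cinner (h 0) b"
  define c where "c = (1 - cinner b b) / (\<kappa> * cnj \<kappa>)"
  have law: "1 - cinner (h (V z)) (h (V w)) = c * (1 - cinner (h z) (h w))"
    if "norm z < 1" "norm w < 1" for z w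
  proof -
    have "cnj \<kappa> = 1 - cinner b (h w)"
      using const[of w] by (simp add: \<kappa>_def flip: cnj_cinner[of b])
    moreover have "\<kappa> = 1 - cinner (h z) b" using const[of z] by (simp add: \<kappa>_def)
    ultimately have "c * (1 - cinner (h z) (h w))
        = 1 - cinner (ball_involution b (h z)) (ball_involution b (h w))"
      using one_minus_cinner_involution[OF b ball ball, OF that] by (simp add: c_def)
    then show ?thesis
      using that eq \<psi>' ball unitary_map_cinner[OF W] by simp
  qed
  have "c = 1"
  proof -
    have "1 - cinner (h 0) (h 0) \<noteq> 0" by (rule one_minus_cinner_nonzero) (simp_all add: ball)
    then show ?thesis using law[of 0 0] by (simp add: unitary_map_zero[OF V])
  qed
  then show ?thesis using law[OF z w] by simp
qed

theorem unitary_hermitian_symmetry_iff: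
  fixes h :: "(complex, 'n::finite) vec \<Rightarrow> (complex, 'k::finite) vec"
  assumes h: "homogeneous_expansion D H h"
    and ball: "\<And>z. norm z < 1 \<Longrightarrow> norm (h z) < 1"
    and V: "unitary_map V" and \<gamma>: "\<gamma> \<in> ball_automorphisms" and \<gamma>V: "\<And>z. norm z < 1 \<Longrightarrow> \<gamma> z = V z"
  shows "\<gamma> \<in> hermitian_invariant_group h \<longleftrightarrow>
    (\<forall>z w. norm z < 1 \<longrightarrow> norm w < 1 \<longrightarrow> cinner (h (V z)) (h (V w)) = cinner (h z) (h w))"
    (is "?L \<longleftrightarrow> ?R")
proof
  assume ?L
  then obtain \<psi> where "\<psi> \<in> ball_automorphisms" "\<And>z. norm z < 1 \<Longrightarrow> h (V z) = \<psi> (h z)"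
    using \<gamma>V by (auto simp: hermitian_invariant_group_def)
  then show ?R using hermitian_symmetry_gram[OF h ball V] by blast
next
  assume ?R
  then obtain W where W: "unitary_map W" "\<And>z. z \<in> ball 0 1 \<Longrightarrow> W (h z) = h (V z)"
    using unitary_extension[of "ball 0 1" h "\<lambda>z. h (V z)"] by auto
  then show ?L
    using \<gamma> \<gamma>V ball unitary_map_automorphism[OF W(1)]
    by (auto simp: hermitian_invariant_group_def intro!: bexI[of _ "restrict W (ball 0 1)"])
qed

section \<open>Juxtaposition\<close>

lemma cinner_tensor_power:
  "cinner (tensor_power TYPE('m::finite) z) (tensor_power TYPE('m) w)
    = cinner (z :: (complex, 'n::finite) vec) w ^ CARD('m)"
proof -
  have "cinner z w ^ CARD('m) = (\<Prod>k\<in>(UNIV :: 'm set). \<Sum>i\<in>UNIV. z $ i * cnj (w $ i))"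
    by (simp add: cinner_def)
  also have "\<dots> = (\<Sum>i\<in>(UNIV :: ('m \<Rightarrow> 'n) set). \<Prod>k\<in>UNIV. z $ i k * cnj (w $ i k))"
    by (subst prod_sum_PiE) auto
  finally show ?thesis by (simp add: cinner_def tensor_power_def prod.distrib)
qed

lemma cinner_tensor_product: "cinner (u \<otimes> v) (u' \<otimes> v') = cinner u u' * cinner v v'"
proof -
  have "cinner (u \<otimes> v) (u' \<otimes> v')
      = (\<Sum>(i, j)\<in>UNIV \<times> UNIV. (u $ i * cnj (u' $ i)) * (v $ j * cnj (v' $ j)))"
    unfolding cinner_def tensor_product_def UNIV_Times_UNIV
    by (intro sum.cong) (auto simp: mult_ac)
  also have "\<dots> = cinner u u' * cinner v v'"
    unfolding cinner_def sum_product by (simp add: sum.cartesian_product)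
  finally show ?thesis .
qed

lemma cinner_orthogonal_sum: "cinner (u \<oplus> v) (u' \<oplus> v') = cinner u u' + cinner v v'"
  unfolding cinner_def orthogonal_sum_def UNIV_Plus_UNIV[symmetric]
  by (simp add: sum.Plus del: UNIV_Plus_UNIV)

lemma scaleR_nth: "(r *\<^sub>R x) $ k = of_real r * (x :: (complex, 'k::finite) vec) $ k"
  unfolding vector_scaleR_component by (rule scaleR_conv_of_real)

lemma cinner_scaleR: "cinner (r *\<^sub>R x) (s *\<^sub>R y) = of_real (r * s) * cinner x y"
  unfolding cinner_def scaleR_nth sum_distrib_left by (intro sum.cong) simp_all

lemma cinner_juxtaposition:
  "cinner (juxtaposition TYPE('m::finite) \<theta> f g z) (juxtaposition TYPE('m) \<theta> f g w)
    = of_real ((cos \<theta>)\<^sup>2) * cinner (f z) (f w)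
      + of_real ((sin \<theta>)\<^sup>2) * (cinner (g z) (g w) * cinner z w ^ CARD('m))"
  unfolding juxtaposition_def cinner_orthogonal_sum cinner_scaleR cinner_tensor_product
    cinner_tensor_power
  by (simp add: power2_eq_square)

lemma norm_juxtaposition_less_1:
  assumes "norm (f z) < 1" "norm (g z) < 1" "norm z < 1"
  shows "norm (juxtaposition TYPE('m::finite) \<theta> f g z) < 1"
proof -
  let ?j = "juxtaposition TYPE('m) \<theta> f g z"
  have "complex_of_real ((norm ?j)\<^sup>2) = of_real ((cos \<theta>)\<^sup>2 * (norm (f z))\<^sup>2
      + (sin \<theta>)\<^sup>2 * ((norm (g z))\<^sup>2 * ((norm z)\<^sup>2) ^ CARD('m)))"
    unfolding cinner_self[symmetric] cinner_juxtaposition by (simp add: cinner_self)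
  then have eq: "(norm ?j)\<^sup>2 = (cos \<theta>)\<^sup>2 * (norm (f z))\<^sup>2
      + (sin \<theta>)\<^sup>2 * ((norm (g z))\<^sup>2 * ((norm z)\<^sup>2) ^ CARD('m))"
    using of_real_eq_iff by blast
  have f: "(norm (f z))\<^sup>2 < 1" and "(norm (g z))\<^sup>2 < 1" "(norm z)\<^sup>2 \<le> 1"
    using assms by (auto simp: abs_square_less_1 abs_square_le_1)
  then have g: "(norm (g z))\<^sup>2 * ((norm z)\<^sup>2) ^ CARD('m) < 1"
    using mult_left_mono[of "((norm z)\<^sup>2) ^ CARD('m)" 1 "(norm (g z))\<^sup>2"]
    by (simp add: power_le_one)
  have "(norm ?j)\<^sup>2 < (cos \<theta>)\<^sup>2 + (sin \<theta>)\<^sup>2"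
  proof (cases "cos \<theta> = 0")
    case True
    then have "(sin \<theta>)\<^sup>2 = 1" using sin_cos_squared_add[of \<theta>] by simp
    then show ?thesis using g True unfolding eq by simp
  next
    case False
    then have "(cos \<theta>)\<^sup>2 * (norm (f z))\<^sup>2 < (cos \<theta>)\<^sup>2 * 1"
      using f by (intro mult_strict_left_mono) auto
    moreover have "(sin \<theta>)\<^sup>2 * ((norm (g z))\<^sup>2 * ((norm z)\<^sup>2) ^ CARD('m)) \<le> (sin \<theta>)\<^sup>2 * 1"
      using g by (intro mult_left_mono) auto
    ultimately show ?thesis unfolding eq by linarith
  qed
  then show ?thesis by (simp add: abs_square_less_1)
qed

lemma juxtaposition_expansion:
  fixes f :: "(complex, 'n::finite) vec \<Rightarrow> (complex, 'k::finite) vec"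
    and g :: "(complex, 'n) vec \<Rightarrow> (complex, 'l::finite) vec"
  assumes f: "homogeneous_expansion d F f" and g: "homogeneous_expansion e G g"
    and "F d x \<noteq> 0" and "cos \<theta> \<noteq> 0"
  obtains D J where "homogeneous_expansion D J (juxtaposition TYPE('m::finite) \<theta> f g)"
    "d \<le> D" "J d x \<noteq> 0"
proof -
  define m where "m = CARD('m)"
  define J :: "nat \<Rightarrow> (complex, 'n) vec \<Rightarrow> (complex, 'k + 'l \<times> ('m \<Rightarrow> 'n)) vec"
    where "J i z = (\<chi> s. case s of
        Inl a \<Rightarrow> if i \<le> d then of_real (cos \<theta>) * F i z $ a else 0
      | Inr p \<Rightarrow> if m \<le> i \<and> i \<le> m + e
                 then of_real (sin \<theta>) * (G (i - m) z $ fst p * (\<Prod>k\<in>UNIV. z $ snd p k)) else 0)"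
    for i z
  define D where "D = d + (m + e)"
  have mono: "hpoly m (\<lambda>z. \<Prod>k\<in>(UNIV :: 'm set). z $ i k)" for i :: "'m \<Rightarrow> 'n"
    using hpoly_prod[OF _ hpoly.coord, of "UNIV :: 'm set" i] by (simp add: m_def)
  have "hpoly i (\<lambda>z. J i z $ s)" for i s
  proof (cases s)
    case (Inl a)
    then show ?thesis
      unfolding J_def using hpoly_cmult[OF homogeneous_expansionD(1)[OF f]]
      by (cases "i \<le> d") (simp_all add: hpoly.zero)
  next
    case (Inr p)
    have "hpoly i (\<lambda>z. G (i - m) z $ fst p * (\<Prod>k\<in>UNIV. z $ snd p k))" if "m \<le> i"
      using hpoly.mult[OF homogeneous_expansionD(1)[OF g, of "i - m" "fst p"] mono, of "snd p"] that
      by simp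
    then show ?thesis
      unfolding J_def Inr using hpoly_cmult by (cases "m \<le> i \<and> i \<le> m + e") (auto simp: hpoly.zero)
  qed
  moreover have "juxtaposition TYPE('m) \<theta> f g z = (\<Sum>i\<le>D. J i z)" for z
  proof -
    have "juxtaposition TYPE('m) \<theta> f g z $ s = (\<Sum>i\<le>D. J i z $ s)" for s
    proof (cases s)
      case (Inl a)
      have "(\<Sum>i\<le>D. J i z $ s) = (\<Sum>i\<le>d. of_real (cos \<theta>) * F i z $ a)"
        unfolding J_def Inl by (rule sum.mono_neutral_cong_right) (auto simp: D_def)
      then show ?thesis
        unfolding Inl juxtaposition_def orthogonal_sum_def homogeneous_expansionD(2)[OF f]
        by (simp add: scaleR_nth sum_distrib_left del: vector_scaleR_component)
    next
      case (Inr p)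
      define M where "M = (\<Prod>k\<in>UNIV. z $ snd p k)"
      have "(\<Sum>i\<le>D. J i z $ s)
          = (\<Sum>i\<in>{0 + m..e + m}. of_real (sin \<theta>) * (G (i - m) z $ fst p * M))"
        unfolding J_def Inr M_def by (rule sum.mono_neutral_cong_right) (auto simp: D_def)
      also have "\<dots> = (\<Sum>i\<le>e. of_real (sin \<theta>) * (G i z $ fst p * M))"
        unfolding sum.shift_bounds_cl_nat_ivl by (simp add: atMost_atLeast0)
      finally show ?thesis
        unfolding Inr juxtaposition_def orthogonal_sum_def tensor_product_def tensor_power_def
          homogeneous_expansionD(2)[OF g]
        by (simp add: M_def scaleR_nth sum_distrib_left sum_distrib_right
            del: vector_scaleR_component)
    qed
    then show ?thesis by (simp add: vec_eq_iff)
  qed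
  ultimately have "homogeneous_expansion D J (juxtaposition TYPE('m) \<theta> f g)"
    by (simp add: homogeneous_expansion_def)
  moreover obtain k where "F d x $ k \<noteq> 0" using \<open>F d x \<noteq> 0\<close> by (metis vec_eq_iff zero_index)
  then have "J d x $ Inl k \<noteq> 0" using \<open>cos \<theta> \<noteq> 0\<close> by (simp add: J_def)
  then have "J d x \<noteq> 0" by (metis zero_index)
  ultimately show ?thesis using that[of D J] by (simp add: D_def)
qed

text \<open>
  Along \<open>t z\<close>, the first summand of the Gram form of the juxtaposition has degree less than \<open>m\<close> in
  \<open>t\<close> and the second is divisible by \<open>t ^ m\<close>, so the form determines both summands.  The factor
  \<open>\<langle>z, w\<rangle> ^ m\<close> can be cancelled where it does not vanish, which is enough by continuation along
  the line \<open>z + t w\<close>.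
\<close>

lemma gram_juxtaposition:
  fixes f :: "(complex, 'n::finite) vec \<Rightarrow> (complex, 'k::finite) vec"
    and g :: "(complex, 'n) vec \<Rightarrow> (complex, 'l::finite) vec"
  assumes f: "homogeneous_expansion d F f" and g: "homogeneous_expansion e G g"
    and m: "d < CARD('m::finite)" and V: "unitary_map V" and \<theta>: "cos \<theta> \<noteq> 0" "sin \<theta> \<noteq> 0"
    and gram: "\<And>z w. norm z < 1 \<Longrightarrow> norm w < 1 \<Longrightarrow>
      cinner (juxtaposition TYPE('m) \<theta> f g (V z)) (juxtaposition TYPE('m) \<theta> f g (V w))
        = cinner (juxtaposition TYPE('m) \<theta> f g z) (juxtaposition TYPE('m) \<theta> f g w)"
    and z: "norm z < 1" and w: "norm w < 1"
  shows "cinner (f (V z)) (f (V w)) = cinner (f z) (f w)"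
    and "cinner (g (V z)) (g (V w)) = cinner (g z) (g w)"
proof -
  have Vline: "polyfun 1 (\<lambda>t. V (t *s u) $ i)" for u i
    using polyfun_unitary_line[OF V, of 0 u i] by simp
  have *: "cinner (f (V z)) (f (V w)) = cinner (f z) (f w)
      \<and> (cinner z w \<noteq> 0 \<longrightarrow> cinner (g (V z)) (g (V w)) = cinner (g z) (g w))"
    if z: "norm z < 1" and w: "norm w < 1" for z w
  proof -
    define A where "A t = of_real ((cos \<theta>)\<^sup>2) *
        (cinner (f (V (t *s z))) (f (V w)) - cinner (f (t *s z)) (f w))" for t
    define B where "B t = (of_real ((sin \<theta>)\<^sup>2) * cinner z w ^ CARD('m)) *
        (cinner (g (V (t *s z))) (g (V w)) - cinner (g (t *s z)) (g w))" for t
    have A: "polyfun d A"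
      unfolding A_def
      by (intro polyfun_cmult polyfun_diff polyfun_cinner homogeneous_expansion_polyfun[OF f]
          Vline polyfun_line0)
    have B: "polyfun e B"
      unfolding B_def
      by (intro polyfun_cmult polyfun_diff polyfun_cinner homogeneous_expansion_polyfun[OF g]
          Vline polyfun_line0)
    have "(\<lambda>t. A t + t ^ CARD('m) * B t) = (\<lambda>_. 0)"
    proof (rule polyfun_eq_near_0)
      show "polyfun (d + (CARD('m) * 1 + e)) (\<lambda>t. A t + t ^ CARD('m) * B t)"
        by (intro polyfun_add polyfun_mono[OF A]
            polyfun_mono[OF polyfun_mult[OF polyfun_power[OF polyfun_ident] B]]) auto
      show "polyfun 0 (\<lambda>_. 0)" by (rule polyfun_const)
      show "(0::real) < 1" by simp
      fix t assume "cmod t < 1"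
      then have tz: "norm (t *s z) < 1"
        using z mult_right_mono[of "cmod t" 1 "norm z"] by (simp add: norm_scale)
      show "A t + t ^ CARD('m) * B t = 0"
        using gram[OF tz w]
        unfolding cinner_juxtaposition unitary_map_cinner[OF V]
        by (simp add: A_def B_def cinner_scale_left power_mult_distrib algebra_simps)
    qed
    then have AB: "A t + t ^ CARD('m) * B t = 0" for t by (rule fun_cong)
    have "A 1 = 0" "B 1 = 0" using polyfun_separate_degrees[OF A m B AB] by blast+
    moreover have "complex_of_real ((cos \<theta>)\<^sup>2) \<noteq> 0" "complex_of_real ((sin \<theta>)\<^sup>2) \<noteq> 0"
      using \<theta> by (simp_all only: of_real_eq_0_iff zero_eq_power2 not_False_eq_True)
    ultimately show ?thesis unfolding A_def B_def mult_eq_0_iff by auto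
  qed
  then show "cinner (f (V z)) (f (V w)) = cinner (f z) (f w)" using z w by blast
  have g1: "cinner (g (V z)) (g (V w)) = cinner (g z) (g w)"
    if z: "norm z < 1" and w: "norm w < 1" and "w \<noteq> 0" for z w
  proof -
    \<comment> \<open>\<open>r\<close> keeps \<open>z + t w\<close> in the ball, and \<open>t0\<close> is the only zero of \<open>\<langle>z + t w, w\<rangle>\<close>.\<close>
    define r where "r = (1 - norm z) / norm w"
    have r: "0 < r" using z \<open>w \<noteq> 0\<close> by (simp add: r_def)
    define t0 where "t0 = - cinner z w / cinner w w"
    have "(\<lambda>t. cinner (g (V (z + t *s w))) (g (V w))) = (\<lambda>t. cinner (g (z + t *s w)) (g w))"
    proof (rule polyfun_eq_infinite)
      show "polyfun e (\<lambda>t. cinner (g (V (z + t *s w))) (g (V w)))"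
        by (intro polyfun_cinner homogeneous_expansion_polyfun[OF g] polyfun_unitary_line[OF V])
      show "polyfun e (\<lambda>t. cinner (g (z + t *s w)) (g w))"
        by (intro polyfun_cinner homogeneous_expansion_polyfun[OF g] polyfun_line)
      have "ball 0 r - {t0}
          \<subseteq> {t. cinner (g (V (z + t *s w))) (g (V w)) = cinner (g (z + t *s w)) (g w)}"
      proof
        fix t assume t: "t \<in> ball 0 r - {t0}"
        then have "cmod t * norm w < 1 - norm z"
          using \<open>w \<noteq> 0\<close> by (simp add: r_def pos_less_divide_eq)
        then have "norm (z + t *s w) < 1"
          using norm_triangle_ineq[of z "t *s w"] by (simp add: norm_scale)
        moreover have "cinner (z + t *s w) w \<noteq> 0"
        proof
          assume "cinner (z + t *s w) w = 0"
          then have "t * cinner w w = - cinner z w"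
            by (simp add: cinner_add_left cinner_scale_left eq_neg_iff_add_eq_0 add.commute)
          moreover have "cinner w w \<noteq> 0" using \<open>w \<noteq> 0\<close> by (simp add: cinner_self)
          ultimately have "t = t0" unfolding t0_def by (metis nonzero_eq_divide_eq)
          then show False using t by simp
        qed
        ultimately show "t \<in> {t. cinner (g (V (z + t *s w))) (g (V w)) = cinner (g (z + t *s w)) (g w)}"
          using * w by blast
      qed
      moreover have "infinite (ball 0 r - {t0})"
        using r uncountable_ball[of r t0] countable_finite
        by (metis finite_Diff2 finite.emptyI finite.insertI uncountable_ball)
      ultimately show "infinite {t. cinner (g (V (z + t *s w))) (g (V w)) = cinner (g (z + t *s w)) (g w)}"
        using finite_subset by blast
    qed
    from fun_cong[OF this, of 0] show ?thesis by simp
  qed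
  show "cinner (g (V z)) (g (V w)) = cinner (g z) (g w)"
  proof (cases "w = 0")
    case False
    then show ?thesis using g1 z w by blast
  next
    case True
    \<comment> \<open>A line in the direction of \<open>w = 0\<close> is a point, so the roles of \<open>z\<close> and \<open>w\<close> are exchanged.\<close>
    show ?thesis
    proof (cases "z = 0")
      case True
      then show ?thesis using \<open>w = 0\<close> by (simp add: unitary_map_zero[OF V])
    next
      case False
      from g1[OF w z this] show ?thesis by (metis cnj_cinner)
    qed
  qed
qed

theorem corollary4p2:
  fixes P :: "('n::finite cpoly, 'n1::finite) vec"
    and Q :: "('n cpoly, 'n2::finite) vec"
    and f :: "(complex, 'n) vec \<Rightarrow> (complex, 'n1) vec"
    and g :: "(complex, 'n) vec \<Rightarrow> (complex, 'n2) vec"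
    and \<theta> :: real
  assumes "f = polynomial_map P" and "proper_ball_map f"
    and "g = polynomial_map Q" and "proper_ball_map g"
    and "polynomial_map_degree P \<ge> 2" and "f 0 = 0"
    and "CARD('m::finite) > polynomial_map_degree P"
    and "0 < \<theta>" and "\<theta> < pi / 2"
  shows "hermitian_invariant_group (juxtaposition TYPE('m) \<theta> f g)
       = hermitian_invariant_group f \<inter> hermitian_invariant_group g"
proof -
  define d where "d = polynomial_map_degree P"
  have d: "2 \<le> d" "d < CARD('m)" using assms(5,7) by (simp_all add: d_def)
  obtain F where F: "homogeneous_expansion d F f" and "d > 0 \<Longrightarrow> \<exists>x. F d x \<noteq> 0"
    using polynomial_map_expansion[of P] unfolding assms(1) d_def by metis
  then obtain x where x: "F d x \<noteq> 0" using d(1) by auto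
  obtain e G where G: "homogeneous_expansion e G g"
    using polynomial_map_expansion[of Q] unfolding assms(3) by metis
  have "0 < cos \<theta>" "0 < sin \<theta>"
    using assms(8,9) by (auto intro!: cos_gt_zero_pi sin_gt_zero)
  then have \<theta>: "cos \<theta> \<noteq> 0" "sin \<theta> \<noteq> 0" by simp_all
  have ball: "norm (h z) < 1" if "proper_ball_map h" "norm z < 1"
    for h :: "(complex, 'n) vec \<Rightarrow> (complex, 'k::finite) vec" and z
    using that proper_map_imp_subset_topspace[of _ _ h]
    unfolding proper_ball_map_def by fastforce
  note f1 = ball[OF assms(2)] and g1 = ball[OF assms(4)]
  define j where "j = juxtaposition TYPE('m) \<theta> f g"
  have j1: "norm (j z) < 1" if "norm z < 1" for z
    unfolding j_def using that f1 g1 by (intro norm_juxtaposition_less_1)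
  \<comment> \<open>The true degree of \<open>j\<close> is at least that of \<open>f\<close>, hence at least \<open>2\<close>, because the part of \<open>j\<close> of
    degree \<open>d\<close> contains \<open>cos \<theta>\<close> times the leading part of \<open>f\<close>.\<close>
  obtain D J where "homogeneous_expansion D J j" "d \<le> D" "J d x \<noteq> 0"
    using juxtaposition_expansion[OF F G x \<theta>(1)] unfolding j_def by blast
  then obtain l y where l: "d \<le> l" "homogeneous_expansion l J j" "J l y \<noteq> 0"
    using homogeneous_expansion_leading by metis
  have j0: "j 0 = 0"
  proof -
    have "cinner (j 0) (j 0) = 0"
      unfolding j_def cinner_juxtaposition using assms(6) by (simp add: card_gt_0_iff)
    then show ?thesis by (simp add: cinner_self)
  qed
  have fix0: "\<gamma> 0 = 0"
    if "\<gamma> \<in> hermitian_invariant_group h" "homogeneous_expansion n H h" "h 0 = 0" "H n u \<noteq> 0" "2 \<le> n"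
      "\<And>z. norm z < 1 \<Longrightarrow> norm (h z) < 1"
    for h :: "(complex, 'n) vec \<Rightarrow> (complex, 'k::finite) vec" and \<gamma> n H u
  proof -
    obtain \<psi> where "\<gamma> \<in> ball_automorphisms" "\<psi> \<in> ball_automorphisms"
      "\<And>z. norm z < 1 \<Longrightarrow> h (\<gamma> z) = \<psi> (h z)"
      using \<open>\<gamma> \<in> hermitian_invariant_group h\<close> by (auto simp: hermitian_invariant_group_def)
    then show ?thesis using hermitian_symmetry_fixes_0[OF that(2-5)] that(6) by blast
  qed
  have main: "\<gamma> \<in> hermitian_invariant_group j
      \<longleftrightarrow> \<gamma> \<in> hermitian_invariant_group f \<inter> hermitian_invariant_group g"
    if \<gamma>: "\<gamma> \<in> ball_automorphisms" "\<gamma> 0 = 0" for \<gamma>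
  proof -
    obtain V where V: "unitary_map V" "\<And>z. norm z < 1 \<Longrightarrow> \<gamma> z = V z"
      using ball_automorphism_fixing_0[OF \<gamma>] by blast
    note iff = unitary_hermitian_symmetry_iff[OF _ _ V(1) \<gamma>(1), OF _ _ V(2)]
    have fV: "\<gamma> \<in> hermitian_invariant_group f \<longleftrightarrow>
        (\<forall>z w. norm z < 1 \<longrightarrow> norm w < 1 \<longrightarrow> cinner (f (V z)) (f (V w)) = cinner (f z) (f w))"
      by (rule iff[OF F]) (auto intro: f1)
    have gV: "\<gamma> \<in> hermitian_invariant_group g \<longleftrightarrow>
        (\<forall>z w. norm z < 1 \<longrightarrow> norm w < 1 \<longrightarrow> cinner (g (V z)) (g (V w)) = cinner (g z) (g w))"
      by (rule iff[OF G]) (auto intro: g1)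
    have jV: "\<gamma> \<in> hermitian_invariant_group j \<longleftrightarrow>
        (\<forall>z w. norm z < 1 \<longrightarrow> norm w < 1 \<longrightarrow> cinner (j (V z)) (j (V w)) = cinner (j z) (j w))"
      by (rule iff[OF l(2)]) (auto intro: j1)
    show ?thesis
      unfolding Int_iff fV gV jV
    proof (intro iffI conjI allI impI)
      fix z w :: "(complex, 'n) vec" assume zw: "norm z < 1" "norm w < 1"
      assume "\<forall>z w. norm z < 1 \<longrightarrow> norm w < 1 \<longrightarrow> cinner (j (V z)) (j (V w)) = cinner (j z) (j w)"
      then have "cinner (j (V z)) (j (V w)) = cinner (j z) (j w)" if "norm z < 1" "norm w < 1" for z w
        using that by blast
      note gram = gram_juxtaposition[OF F G d(2) V(1) \<theta> this[unfolded j_def] zw]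
      show "cinner (f (V z)) (f (V w)) = cinner (f z) (f w)" by (rule gram(1))
      show "cinner (g (V z)) (g (V w)) = cinner (g z) (g w)" by (rule gram(2))
    next
      fix z w :: "(complex, 'n) vec" assume zw: "norm z < 1" "norm w < 1"
      assume "(\<forall>z w. norm z < 1 \<longrightarrow> norm w < 1 \<longrightarrow> cinner (f (V z)) (f (V w)) = cinner (f z) (f w))
        \<and> (\<forall>z w. norm z < 1 \<longrightarrow> norm w < 1 \<longrightarrow> cinner (g (V z)) (g (V w)) = cinner (g z) (g w))"
      then show "cinner (j (V z)) (j (V w)) = cinner (j z) (j w)"
        unfolding j_def cinner_juxtaposition unitary_map_cinner[OF V(1)] using zw by simp
    qed
  qed
  have sub: "hermitian_invariant_group h \<subseteq> ball_automorphisms"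
    for h :: "(complex, 'n) vec \<Rightarrow> (complex, 'k::finite) vec"
    by (auto simp: hermitian_invariant_group_def)
  have "hermitian_invariant_group j = hermitian_invariant_group f \<inter> hermitian_invariant_group g"
  proof (intro equalityI subsetI)
    fix \<gamma> assume \<gamma>: "\<gamma> \<in> hermitian_invariant_group j"
    then have "\<gamma> 0 = 0" using l d by (intro fix0[OF \<gamma> l(2) j0 l(3) _ j1]) auto
    then show "\<gamma> \<in> hermitian_invariant_group f \<inter> hermitian_invariant_group g"
      using main \<gamma> sub by blast
  next
    fix \<gamma> assume \<gamma>: "\<gamma> \<in> hermitian_invariant_group f \<inter> hermitian_invariant_group g"
    then have "\<gamma> 0 = 0" by (intro fix0[OF _ F assms(6) x d(1) f1]) auto
    then show "\<gamma> \<in> hermitian_invariant_group j"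
      using main \<gamma> sub by blast
  qed
  then show ?thesis by (simp only: j_def)
qed

end
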